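(* There exist absolute constants $c>0$ and $N$ such that the following holds. Let $n>N$ be an integer with $\gcd(n,6)=1$, and let $a,b$ be integers coprime to $n$. Suppose that none of the pairs $(x,y)\in\{(1,a),(1,b),(a,b)\}$ satisfies $x+y\equiv 0\pmod n$ or $x-y\equiv 0\pmod n$, and that at least one of these three pairs $(x,y)$ satisfies none of the relations $x+3y\equiv0$, $x-3y\equiv 0$, $3x+y\equiv 0$, $3x-y\equiv 0\pmod n$. Then $$\#\left\{g\in(\mathbb{Z}/n)^*:\ \tfrac{(g)_n}{n}\in I,\ \tfrac{(ag)_n}{n}\in I,\ \tfrac{(bg)_n}{n}\in I\right\}\ge c\,\phi(n),$$ where $I=[0,1/2]$.
   Context: $(\mathbb{Z}/n)^*$ is the group of units modulo $n$; for an integer $x$, $(x)_n$ denotes the least non-negative integer congruent to $x$ modulo $n$; $\phi$ is Euler's totient function. *)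

theory Defs
  imports Complex_Main "HOL-Number_Theory.Number_Theory"
begin

end

theory Submission
  imports Defs "HOL-Analysis.Analysis" "HOL-Real_Asymp.Real_Asymp"
begin

text \<open>
  Let \<open>s(x)\<close> be the sign of \<open>sin (2 pi x / n)\<close>. The indicator of \<open>(x)\<^sub>n / n \<in> [0, 1/2]\<close> is
  \<open>(1 + s(x)) / 2\<close>, and since \<open>s\<close> is odd the symmetry \<open>g \<mapsto> -g\<close> turns the count into
  \<open>(1/8) \<Sum>\<^sub>g (1 + s(g) s(a g) + s(g) s(b g) + s(a g) s(b g))\<close>. So the three correlations of \<open>s\<close>
  must not add up to \<open>-1\<close>.

  Replace \<open>s\<close> by an odd trigonometric polynomial \<open>P\<close> whose \<open>k\<close>-th sine coefficient (\<open>k\<close> odd) is at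
  most \<open>4 / (pi k)\<close>, with \<open>\<bar>s - P\<bar> \<le> 1 - P\<^sup>2\<close> pointwise, so that the error is controlled by the mean
  of \<open>P\<^sup>2\<close>. The correlation of \<open>P(x g)\<close> and \<open>P(y g)\<close> is a combination of normalised Ramanujan sums
  at \<open>k x + l y\<close>, and such a sum is at most \<open>1 / \<phi>(q)\<close>, where \<open>q\<close> is the additive order of
  \<open>k x + l y\<close> modulo \<open>n\<close>. For large \<open>n\<close> the frequencies \<open>(k, l)\<close> of small order are odd multiples of
  one primitive pair \<open>(k\<^sub>0, l\<^sub>0)\<close>, and they contribute at most \<open>1 / \<bar>k\<^sub>0 l\<^sub>0\<bar>\<close>, because the inverse
  squares of the odd numbers sum to \<open>pi\<^sup>2 / 8\<close>. If \<open>k\<^sub>0 x + l\<^sub>0 y\<close> is nonzero modulo \<open>n\<close>, the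
  multiples \<open>1\<close> and \<open>3\<close> only count with weight \<open>1 / 4\<close>, as \<open>n\<close> is coprime to \<open>6\<close>, and the bound drops
  to \<open>1 - 20 / (3 pi\<^sup>2) < 1 / 3\<close>. Hence every correlation is at most about \<open>1 / 3\<close> in absolute value,
  and strictly less for a pair that satisfies no relation with coefficients \<open>1\<close> and \<open>3\<close>.
\<close>

section \<open>Ramanujan sums\<close>

definition add_char :: "nat \<Rightarrow> int \<Rightarrow> complex" where
  "add_char n x = cis (2 * pi * of_int x / of_nat n)"

lemma add_char_add: "add_char n (x + y) = add_char n x * add_char n y"
  by (simp add: add_char_def cis_mult ring_distribs add_divide_distrib)

lemma add_char_multiple:
  assumes "n > 0" shows "add_char n (int n * x) = 1"
proof -
  have "add_char n (int n * x) = cis (2 * pi * of_int x)"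
    using assms by (simp add: add_char_def mult.assoc)
  also have "\<dots> = 1" by (rule cis_multiple_2pi) simp
  finally show ?thesis .
qed

lemma add_char_cong:
  assumes "n > 0" "[x = y] (mod int n)"
  shows "add_char n x = add_char n y"
proof -
  obtain k where "x = y + int n * k"
    using assms(2) by (metis cong_iff_lin cong_sym)
  then show ?thesis using assms(1) by (simp add: add_char_add add_char_multiple)
qed

lemma add_char_eq_1_imp_dvd:
  assumes "n > 0" "add_char n x = 1"
  shows "int n dvd x"
proof -
  have "cos (2 * pi * of_int x / of_nat n) = 1"
    using assms(2) by (simp add: add_char_def complex_eq_iff)
  then obtain k where "2 * pi * of_int x / of_nat n = of_int k * (2 * pi)"
    by (auto simp: cos_one_2pi_int)
  then have "real_of_int x = of_int k * of_nat n"
    using assms(1) by (simp add: field_simps)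
  then have "real_of_int x = of_int (k * int n)" by simp
  then have "x = k * int n" by (simp only: of_int_eq_iff)
  then show ?thesis by simp
qed

text \<open>The terms form a geometric progression whose ratio is an n-th root of unity. The range
  runs from 1 to n so that it contains \<open>totatives n\<close>, over which Ramanujan sums are
  taken.\<close>

lemma sum_add_char:
  assumes "n > 0"
  shows "(\<Sum>h\<in>{0<..n}. add_char n (z * int h)) = (if int n dvd z then of_nat n else 0)"
proof (cases "int n dvd z")
  case True
  then have "add_char n (z * int h) = 1" for h
    using add_char_multiple[OF assms] by (auto simp: mult.assoc elim!: dvdE)
  then show ?thesis using True by simp
next
  case False
  have pow: "add_char n (z * int h) = add_char n z ^ h" for h
    by (induction h) (simp_all add: add_char_add ring_distribs, simp add: add_char_def)
  have "add_char n z \<noteq> 1" using add_char_eq_1_imp_dvd[OF assms] False by blast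
  moreover have "add_char n z ^ n = 1"
    using add_char_multiple[OF assms, of z] by (simp add: pow[symmetric] mult.commute)
  ultimately have "(\<Sum>h<n. add_char n z ^ h) = 0"
    by (simp add: geometric_sum)
  moreover have "(\<Sum>h\<in>{0<..n}. add_char n z ^ h) = (\<Sum>h<n. add_char n z ^ Suc h)"
    by (rule sum.reindex_bij_witness[of _ Suc "\<lambda>h. h - 1"]) auto
  moreover have "\<dots> = add_char n z * (\<Sum>h<n. add_char n z ^ h)"
    by (simp add: sum_distrib_left)
  ultimately show ?thesis using False by (simp add: pow)
qed

section \<open>Ramanujan sums and their size in terms of the additive order\<close>

definition ramanujan_sum :: "nat \<Rightarrow> int \<Rightarrow> complex" where
  "ramanujan_sum n z = (\<Sum>g\<in>totatives n. add_char n (z * int g))"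

text \<open>For n > 0 this is the order of z in the additive group of residues modulo n, that is,
  the denominator of z / n in lowest terms.\<close>

definition add_order :: "nat \<Rightarrow> int \<Rightarrow> nat" where
  "add_order n z = n div nat (gcd (int n) z)"

lemma add_order_mult_gcd: "add_order n z * nat (gcd (int n) z) = n"
proof -
  have "int (nat (gcd (int n) z)) dvd int n" by simp
  then have "nat (gcd (int n) z) dvd n" by (simp only: int_dvd_int_iff)
  then show ?thesis by (simp add: add_order_def)
qed

lemma add_order_pos: "n > 0 \<Longrightarrow> add_order n z > 0"
  using add_order_mult_gcd[of n z] by (auto intro!: Nat.gr0I)

lemma add_order_dvd: "add_order n z dvd n"
  by (metis add_order_mult_gcd dvd_triv_left)

lemma dvd_add_order_mult: "int n dvd int (add_order n z) * z"
proof -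
  have "int n = int (add_order n z) * gcd (int n) z"
    by (metis add_order_mult_gcd gcd_ge_0_int int_nat_eq of_nat_mult)
  then show ?thesis by (metis dvd_refl gcd_dvd2 mult_dvd_mono)
qed

lemma add_order_eq_1: "n > 0 \<Longrightarrow> add_order n z = 1 \<Longrightarrow> int n dvd z"
  using dvd_add_order_mult[of n z] by simp

text \<open>Chinese remainder theorem, with the character split by the partial fractions 1 / (m1 m2)
  = u / m1 + v / m2. The twists by the units u and v are kept: they preserve the additive order,
  which is all that the later bound sees of z.\<close>

lemma ramanujan_sum_mult:
  assumes "m1 > 1" "m2 > 1" "coprime m1 m2"
  obtains u v where "coprime u (int m1)" "coprime v (int m2)"
    "ramanujan_sum (m1 * m2) z = ramanujan_sum m1 (u * z) * ramanujan_sum m2 (v * z)"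
proof -
  obtain u v where "u * int m2 + v * int m1 = gcd (int m2) (int m1)"
    using bezout_int by blast
  moreover have "gcd (int m2) (int m1) = 1"
    using assms(3) by (simp add: coprime_iff_gcd_eq_1[symmetric] coprime_commute)
  ultimately have uv: "u * int m2 + v * int m1 = 1" by simp
  have cu: "coprime u (int m1)"
  proof (rule coprimeI)
    fix d assume "d dvd u" "d dvd int m1"
    then have "d dvd u * int m2 + v * int m1" by simp
    then show "is_unit d" by (simp add: uv)
  qed
  have cv: "coprime v (int m2)"
  proof (rule coprimeI)
    fix d assume "d dvd v" "d dvd int m2"
    then have "d dvd u * int m2 + v * int m1" by simp
    then show "is_unit d" by (simp add: uv)
  qed
  have split: "add_char (m1 * m2) (z * int g) =
      add_char m1 (u * z * int (g mod m1)) * add_char m2 (v * z * int (g mod m2))" for g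
  proof -
    have "add_char (m1 * m2) (z * int g) = add_char (m1 * m2) ((u * int m2 + v * int m1) * (z * int g))"
      using uv by simp
    also have "\<dots> = add_char m1 (u * z * int g) * add_char m2 (v * z * int g)"
      using assms(1,2) by (simp add: ring_distribs add_char_add) (simp add: add_char_def mult_ac)
    also have "add_char m1 (u * z * int g) = add_char m1 (u * z * int (g mod m1))"
      using assms(1) by (intro add_char_cong cong_scalar_left) (simp_all add: zmod_int cong_def)
    also have "add_char m2 (v * z * int g) = add_char m2 (v * z * int (g mod m2))"
      using assms(2) by (intro add_char_cong cong_scalar_left) (simp_all add: zmod_int cong_def)
    finally show ?thesis .
  qed
  have "ramanujan_sum (m1 * m2) z =
     (\<Sum>g\<in>totatives (m1 * m2). (\<lambda>(a, b). add_char m1 (u * z * int a) * add_char m2 (v * z * int b)) (g mod m1, g mod m2))"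
    unfolding ramanujan_sum_def by (simp add: split)
  also have "\<dots> = (\<Sum>(a, b)\<in>totatives m1 \<times> totatives m2. add_char m1 (u * z * int a) * add_char m2 (v * z * int b))"
    by (rule sum.reindex_bij_betw[OF bij_betw_totatives[OF assms]])
  also have "\<dots> = ramanujan_sum m1 (u * z) * ramanujan_sum m2 (v * z)"
    by (simp add: ramanujan_sum_def sum_product sum.cartesian_product)
  finally show thesis using that cu cv by blast
qed

text \<open>Removing the multiples of p from 1, ..., p^(k+1) leaves the totatives. So the sum is a
  difference of two complete character sums, the second one to the modulus p^k.\<close>

lemma ramanujan_sum_prime_power:
  assumes "prime p"
  shows "ramanujan_sum (p ^ Suc k) z =
    (if int (p ^ Suc k) dvd z then of_nat (p ^ Suc k) else 0) - (if int (p ^ k) dvd z then of_nat (p ^ k) else 0)"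
proof -
  have p: "p > 0" using assms prime_gt_0_nat by blast
  let ?f = "\<lambda>g. add_char (p ^ Suc k) (z * int g)"
  have "(*) p ` {0<..p ^ k} \<subseteq> {0<..p ^ Suc k}" using p by auto
  then have "ramanujan_sum (p ^ Suc k) z = sum ?f {0<..p ^ Suc k} - sum ?f ((*) p ` {0<..p ^ k})"
    unfolding ramanujan_sum_def totatives_prime_power_Suc[OF assms]
    by (intro sum_diff) auto
  also have "sum ?f ((*) p ` {0<..p ^ k}) = (\<Sum>h\<in>{0<..p ^ k}. add_char (p ^ k) (z * int h))"
    using p by (subst sum.reindex) (auto simp: inj_on_def add_char_def mult.assoc intro!: sum.cong)
  finally show ?thesis
    using sum_add_char[of "p ^ Suc k" z] sum_add_char[of "p ^ k" z] p by simp
qed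

lemma add_order_mult_unit:
  assumes "coprime u (int n)"
  shows "add_order n (u * z) = add_order n z"
proof -
  have "gcd (int n) (u * z) = gcd (int n) z"
    using assms by (intro gcd_mult_right_left_cancel) (simp add: coprime_commute)
  then show ?thesis by (simp add: add_order_def)
qed

lemma add_order_mult_coprime:
  assumes "coprime m1 m2"
  shows "add_order (m1 * m2) z = add_order m1 z * add_order m2 z"
proof -
  define g1 g2 where "g1 = nat (gcd (int m1) z)" and "g2 = nat (gcd (int m2) z)"
  have c: "coprime (gcd (int m1) z) (gcd (int m2) z)"
    using assms by (meson coprime_divisors coprime_int_iff gcd_dvd1)
  have "gcd (int m1 * int m2) z dvd gcd (int m1) z * gcd (int m2) z"
  proof -
    obtain b c where "gcd (int m1 * int m2) z = b * c" "b dvd int m1" "c dvd int m2"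
      using division_decomp[of "gcd (int m1 * int m2) z" "int m1" "int m2"] by auto
    moreover from this have "b dvd z" "c dvd z"
      by (metis dvd_mult_left dvd_mult_right gcd_dvd2)+
    ultimately show ?thesis by (simp add: mult_dvd_mono)
  qed
  then have "gcd (int m1 * int m2) z = gcd (int m1) z * gcd (int m2) z"
    using c by (intro zdvd_antisym_nonneg gcd_greatest divides_mult) (auto intro: mult_dvd_mono)
  then have "nat (gcd (int (m1 * m2)) z) = g1 * g2"
    by (simp add: g1_def g2_def nat_mult_distrib)
  moreover have "g1 dvd m1" "g2 dvd m2"
    unfolding g1_def g2_def by (metis add_order_mult_gcd dvd_triv_right)+
  ultimately show ?thesis
    by (simp add: add_order_def g1_def g2_def div_mult_div_if_dvd)
qed

text \<open>Splits off the full power of one prime, so that multiplicative inequalities follow by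
  induction on the smaller cofactor \<open>m\<close>.\<close>

lemma prime_power_split:
  assumes "n > (1::nat)"
  obtains p k m where "prime p" "n = p ^ Suc k * m" "coprime (p ^ Suc k) m" "m > 0" "m < n"
proof -
  obtain p where p: "prime p" "p dvd n" using assms prime_factor_nat[of n] by auto
  define k where "k = multiplicity p n"
  have "k > 0" using p assms by (simp add: k_def prime_multiplicity_gt_zero_iff)
  obtain m where m: "n = p ^ k * m" "\<not> p dvd m"
    using multiplicity_decompose'[of n p] p assms unfolding k_def
    by (metis not_one_less_zero not_prime_unit)
  have "k = Suc (k - 1)" using \<open>k > 0\<close> by simp
  moreover have "coprime (p ^ k) m" using m(2) p(1) by (simp add: prime_imp_coprime)
  moreover have "m > 0" using m assms by (auto intro!: Nat.gr0I)
  moreover have "m < n"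
  proof -
    have "1 < p ^ k" using \<open>k > 0\<close> prime_gt_1_nat[OF p(1)] by (intro one_less_power)
    then show ?thesis using m(1) \<open>m > 0\<close> by simp
  qed
  ultimately show thesis using that[of p "k - 1" m] p(1) m(1) by simp
qed

text \<open>The inequality contained in Hoelder's formula, where the sum equals mu(q) phi(n) /
  phi(q) for q the additive order of z. In the multiplied-out form every factor is multiplicative
  over coprime parts, so prime powers suffice.\<close>

lemma norm_ramanujan_sum_le:
  assumes "n > 0"
  shows "norm (ramanujan_sum n z) * totient (add_order n z) \<le> totient n"
  using assms
proof (induction n arbitrary: z rule: less_induct)
  case (less n)
  show ?case
  proof (cases "n = 1")
    case True
    then show ?thesis by (simp add: ramanujan_sum_def add_char_def add_order_def)
  next
    case False
    then obtain p k m where pk: "prime p" "n = p ^ Suc k * m" "coprime (p ^ Suc k) m" "m > 0" "m < n"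
      using prime_power_split[of n] less.prems by auto
    define q where "q = p ^ Suc k"
    have p: "p > 1" using prime_gt_1_nat[OF pk(1)] .
    then have q: "q > 1" unfolding q_def by (intro one_less_power) auto
    have prime_power: "norm (ramanujan_sum q z) * totient (add_order q z) \<le> totient q" for z
    proof -
      have tq: "totient q = p ^ k * (p - 1)"
        unfolding q_def using totient_prime_power_Suc[OF pk(1)] by simp
      have rq: "ramanujan_sum q z =
          (if int q dvd z then of_nat q else 0) - (if int (p ^ k) dvd z then of_nat (p ^ k) else 0)"
        unfolding q_def by (rule ramanujan_sum_prime_power[OF pk(1)])
      \<comment> \<open>In these cases the additive order is 1, is p, or is divisible by p^2, and
        the sum is phi(q), -p^k, or 0.\<close>
      consider "int q dvd z" | "\<not> int q dvd z" "int (p ^ k) dvd z" | "\<not> int (p ^ k) dvd z"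
        by blast
      then show ?thesis
      proof cases
        case 1
        then have "add_order q z = 1" using q by (simp add: add_order_def gcd_proj1_if_dvd)
        moreover have "int (p ^ k) dvd z"
          using 1 by (rule dvd_trans[rotated]) (simp add: q_def)
        moreover have "norm (of_nat q - of_nat (p ^ k) :: complex) = real (totient q)"
        proof -
          have "p ^ k \<le> q" using p by (simp add: q_def)
          then have "of_nat q - of_nat (p ^ k) = (of_nat (q - p ^ k) :: complex)"
            by (rule of_nat_diff[symmetric])
          moreover have "q - p ^ k = totient q" by (subst tq) (simp add: q_def diff_mult_distrib2 mult.commute)
          ultimately show ?thesis by (simp only: norm_of_nat)
        qed
        ultimately show ?thesis
          using 1 by (simp add: rq)
      next
        case 2
        have "add_order q z dvd p"
        proof -
          have "p ^ k dvd nat (gcd (int q) z)"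
            using 2(2) by (subst int_dvd_int_iff[symmetric]) (simp add: q_def)
          then obtain r where r: "nat (gcd (int q) z) = p ^ k * r" by (elim dvdE)
          have "add_order q z * (p ^ k * r) = q" using add_order_mult_gcd[of q z] r by simp
          then have "p ^ k * (add_order q z * r) = p ^ k * p"
            by (simp add: q_def mult_ac)
          then have "add_order q z * r = p" using p by simp
          then show ?thesis by (metis dvd_triv_left)
        qed
        then have "totient (add_order q z) dvd totient p" by (rule totient_dvd)
        then have "totient (add_order q z) \<le> p - 1"
          using p totient_prime[OF pk(1)] by (auto dest: dvd_imp_le)
        then show ?thesis
          using 2 by (simp add: rq tq norm_power flip: of_nat_mult of_nat_power)
      next
        case 3
        then have "\<not> int q dvd z" unfolding q_def by (metis dvd_trans dvd_triv_right of_nat_mult power_Suc)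
        then show ?thesis using 3 by (simp add: rq)
      qed
    qed
    show ?thesis
    proof (cases "m = 1")
      case True
      then show ?thesis using prime_power pk(2) q_def by simp
    next
      case False
      have cop: "coprime q m" using pk(3) q_def by simp
      have n_eq: "n = q * m" using pk(2) q_def by simp
      obtain u v where uv: "coprime u (int q)" "coprime v (int m)"
        "ramanujan_sum (q * m) z = ramanujan_sum q (u * z) * ramanujan_sum m (v * z)"
        using ramanujan_sum_mult[of q m z] q False pk(4) cop by auto
      have "norm (ramanujan_sum n z) * totient (add_order n z) =
        (norm (ramanujan_sum q (u * z)) * totient (add_order q (u * z))) *
        (norm (ramanujan_sum m (v * z)) * totient (add_order m (v * z)))"
      proof -
        have "coprime (add_order q z) (add_order m z)"
          using cop add_order_dvd by (meson coprime_divisors)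
        then show ?thesis
          using uv cop by (simp add: n_eq norm_mult add_order_mult_coprime
            totient_mult_coprime add_order_mult_unit)
      qed
      also have "\<dots> \<le> real (totient q) * real (totient m)"
        using prime_power less.IH[OF pk(5,4)] by (intro mult_mono) auto
      also have "\<dots> = totient n"
        using cop totient_mult_coprime[of q m] by (simp add: n_eq)
      finally show ?thesis .
    qed
  qed
qed

section \<open>Lower bounds for the totient\<close>

lemma le_totient_square:
  assumes "odd n"
  shows "n \<le> totient n ^ 2"
  using assms
proof (induction n rule: less_induct)
  case (less n)
  show ?case
  proof (cases "n = 1")
    case False
    moreover have "n > 0" using less.prems by (rule odd_pos)
    ultimately obtain p k m where pk: "prime p" "n = p ^ Suc k * m" "coprime (p ^ Suc k) m" "m > 0" "m < n"
      using prime_power_split[of n] by auto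
    have odd: "odd p" "odd m" using less.prems pk(2) by auto
    then have "p \<ge> 3" using prime_ge_2_nat[OF pk(1)] by (cases "p = 2") auto
    \<comment> \<open>Oddness enters here: p \<le> (p - 1)^2 fails for p = 2. The shift by 3 turns
      it into a comparison of polynomials with nonnegative coefficients.\<close>
    define r where "r = p - 3"
    have "p = r + 3" using \<open>p \<ge> 3\<close> r_def by simp
    then have "p \<le> (p - 1) ^ 2" by (simp add: power2_eq_square algebra_simps)
    moreover have "p ^ k \<le> (p ^ k) ^ 2" using \<open>p \<ge> 3\<close> by (simp add: power2_eq_square)
    ultimately have "p * p ^ k \<le> (p - 1) ^ 2 * (p ^ k) ^ 2" by (rule mult_le_mono)
    then have "p ^ Suc k \<le> totient (p ^ Suc k) ^ 2"
      using totient_prime_power_Suc[OF pk(1)] by (simp add: power_mult_distrib mult.commute)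
    then have "p ^ Suc k * m \<le> totient (p ^ Suc k) ^ 2 * totient m ^ 2"
      using less.IH[OF pk(5) odd(2)] by (rule mult_le_mono)
    then show ?thesis
      using pk(2,3) by (simp only: totient_mult_coprime power_mult_distrib)
  qed simp
qed

text \<open>Here n is at least 5, the totient is even, and the value 2 would force n \<le> 4 by
  \<open>le_totient_square\<close>. This is the source of the weight 1/4 for nonzero
  frequencies.\<close>

lemma totient_ge_4:
  assumes "gcd n 6 = 1" "n \<noteq> (1::nat)"
  shows "totient n \<ge> 4"
proof -
  have n2: "odd n" and n3: "\<not> 3 dvd n"
    using gcd_greatest[of 2 n 6] gcd_greatest[of 3 n 6] assms(1) by auto
  have "n \<noteq> 3" using n3 by auto
  then have "n \<ge> 5" using assms(2) n2 by (cases "n = 0"; cases "n = 2"; cases "n = 4") auto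
  have "totient n \<noteq> 2"
  proof
    assume "totient n = 2"
    then show False using le_totient_square[OF n2] \<open>n \<ge> 5\<close> by simp
  qed
  moreover have "even (totient n)" using \<open>n \<ge> 5\<close> by (intro totient_even) simp
  moreover have "totient n > 0" using \<open>n \<ge> 5\<close> by simp
  ultimately show ?thesis by presburger
qed

section \<open>Polynomial approximation of the sign function\<close>

lemma central_binomial_Suc:
  "real (Suc m) * real (2 * Suc m choose Suc m) = 2 * (2 * real m + 1) * real (2 * m choose m)"
proof -
  have "Suc m * (2 * Suc m choose Suc m) = 2 * Suc m * (Suc (2 * m) choose m)"
    using Suc_times_binomial_eq[of "Suc (2 * m)" m] by (simp add: mult.commute)
  moreover have "Suc m * (Suc (2 * m) choose m) = Suc (2 * m) * (2 * m choose m)"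
  proof -
    have "(Suc (2 * m) choose m) = (Suc (2 * m) choose Suc m)"
      by (subst binomial_symmetric) auto
    then show ?thesis using Suc_times_binomial_eq[of "2 * m" m] by (simp add: mult.commute)
  qed
  ultimately have "Suc m * (2 * Suc m choose Suc m) = 2 * (Suc (2 * m) * (2 * m choose m))"
    by (simp only: mult.assoc)
  then have "real (Suc m * (2 * Suc m choose Suc m)) = real (2 * (Suc (2 * m) * (2 * m choose m)))"
    by (simp only:)
  then show ?thesis by (simp add: algebra_simps)
qed

text \<open>Truncation of the binomial series of \<open>u (1 - (1 - u\<^sup>2)) powr (-1/2) = u / \<bar>u\<bar>\<close>.\<close>

definition sgn_approx :: "nat \<Rightarrow> real \<Rightarrow> real" where
  "sgn_approx m u = u * (\<Sum>i\<le>m. real (2 * i choose i) / 4 ^ i * (1 - u\<^sup>2) ^ i)"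

text \<open>The derivative telescopes: writing u^2 = 1 - (1 - u^2) in the derivative of the new term
  cancels the old power. Thus \<open>sgn_approx m\<close> is a normalised integral of (1 - t^2)^m,
  which gives monotonicity on [0, 1] and, after u = sin, a pure odd power of the cosine.\<close>

lemma sgn_approx_has_derivative:
  "(sgn_approx m has_real_derivative (2 * real m + 1) * real (2 * m choose m) / 4 ^ m * (1 - u\<^sup>2) ^ m) (at u)"
proof (induction m)
  case 0
  have "sgn_approx 0 = (\<lambda>u. u)" by (simp add: sgn_approx_def fun_eq_iff)
  then show ?case by simp
next
  case (Suc m)
  define X Y where "X = real (2 * Suc m choose Suc m)" and "Y = real (2 * m choose m)"
  define c where "c = X / 4 ^ Suc m"
  have c: "(2 * real m + 1) * real (2 * m choose m) / 4 ^ m = 2 * real (Suc m) * c"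
  proof -
    have "2 * real (Suc m) * c = 2 * (real (Suc m) * X) / (4 * 4 ^ m)"
      unfolding c_def power_Suc by (simp only: times_divide_eq_right mult.assoc)
    also have "\<dots> = (2 * real m + 1) * Y / 4 ^ m"
      unfolding central_binomial_Suc[of m, folded X_def Y_def] by (auto simp: field_simps)
    finally show ?thesis unfolding Y_def by (rule sym)
  qed
  have eq: "sgn_approx (Suc m) = (\<lambda>u. sgn_approx m u + c * (u * (1 - u\<^sup>2) ^ Suc m))"
    unfolding sgn_approx_def c_def X_def fun_eq_iff sum.atMost_Suc
    by (simp only: distrib_left mult_ac simp_thms)
  have "((\<lambda>u. c * (u * (1 - u\<^sup>2) ^ Suc m)) has_real_derivative
      c * ((1 - u\<^sup>2) ^ Suc m - 2 * real (Suc m) * u\<^sup>2 * (1 - u\<^sup>2) ^ m)) (at u)"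
  proof -
    have "((\<lambda>u. 1 - u\<^sup>2) has_real_derivative - (2 * u)) (at u)"
      by (auto intro!: derivative_eq_intros)
    from DERIV_cmult[OF DERIV_mult[OF DERIV_ident DERIV_power_Suc[OF this]], of c m]
    show ?thesis by (rule DERIV_cong) (simp add: power2_eq_square algebra_simps)
  qed
  from DERIV_add[OF Suc this]
  have "(sgn_approx (Suc m) has_real_derivative
      2 * real (Suc m) * c * (1 - u\<^sup>2) ^ m + c * ((1 - u\<^sup>2) ^ Suc m - 2 * real (Suc m) * u\<^sup>2 * (1 - u\<^sup>2) ^ m)) (at u)"
    by (simp only: eq c)
  moreover have "2 * real (Suc m) * c * (1 - u\<^sup>2) ^ m + c * ((1 - u\<^sup>2) ^ Suc m - 2 * real (Suc m) * u\<^sup>2 * (1 - u\<^sup>2) ^ m)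
     = (2 * real (Suc m) + 1) * real (2 * Suc m choose Suc m) / 4 ^ Suc m * (1 - u\<^sup>2) ^ Suc m"
    unfolding X_def[symmetric] c_def by (simp add: field_simps)
  ultimately show ?case by simp
qed

lemma sgn_approx_minus: "sgn_approx m (- u) = - sgn_approx m u"
  by (simp add: sgn_approx_def)

lemma sgn_approx_1: "sgn_approx m 1 = 1"
proof -
  have "(\<Sum>i\<le>m. real (2 * i choose i) / 4 ^ i * (0::real) ^ i) = (\<Sum>i\<le>m. if i = 0 then 1 else 0)"
    by (intro sum.cong) auto
  then show ?thesis by (simp add: sgn_approx_def)
qed

lemma sgn_approx_bounds:
  assumes "0 \<le> u" "u \<le> 1"
  shows "0 \<le> sgn_approx m u" "sgn_approx m u \<le> 1"
proof -
  have "u\<^sup>2 \<le> 1" using assms by (simp add: power_le_one)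
  then show "0 \<le> sgn_approx m u"
    using assms by (auto simp: sgn_approx_def intro!: mult_nonneg_nonneg sum_nonneg)
  have "sgn_approx m u \<le> sgn_approx m 1"
  proof (rule DERIV_nonneg_imp_nondecreasing[OF assms(2)])
    fix x assume "u \<le> x" "x \<le> 1"
    then have "x\<^sup>2 \<le> 1" using assms by (simp add: power_le_one)
    then show "\<exists>y. (sgn_approx m has_real_derivative y) (at x) \<and> 0 \<le> y"
      using sgn_approx_has_derivative[of m x] by (intro exI conjI) (assumption, simp)
  qed
  then show "sgn_approx m u \<le> 1" by (simp add: sgn_approx_1)
qed

text \<open>For 0 < u \<le> 1 the value p lies in [0, 1], so p^2 \<le> p and 1 - p \<le> 1 - p^2;
  oddness gives negative u, and at 0 both functions vanish. The form 1 - p^2 is chosen because its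
  mean over the units is one minus a self-correlation.\<close>

lemma sgn_approx_error:
  assumes "\<bar>u\<bar> \<le> 1"
  shows "\<bar>sgn u - sgn_approx m u\<bar> \<le> 1 - (sgn_approx m u)\<^sup>2" "\<bar>sgn_approx m u\<bar> \<le> 1"
proof -
  have pos: "\<bar>sgn u - sgn_approx m u\<bar> \<le> 1 - (sgn_approx m u)\<^sup>2 \<and> \<bar>sgn_approx m u\<bar> \<le> 1"
    if "0 < u" "u \<le> 1" for u
  proof -
    have b: "0 \<le> sgn_approx m u" "sgn_approx m u \<le> 1" using sgn_approx_bounds[of u m] that by auto
    then have "(sgn_approx m u)\<^sup>2 \<le> sgn_approx m u"
      by (simp add: power2_eq_square mult_left_le)
    then show ?thesis using b that by simp
  qed
  consider "u > 0" | "u = 0" | "u < 0" by linarith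
  then have "\<bar>sgn u - sgn_approx m u\<bar> \<le> 1 - (sgn_approx m u)\<^sup>2 \<and> \<bar>sgn_approx m u\<bar> \<le> 1"
  proof cases
    case 1 then show ?thesis using pos assms by simp
  next
    case 2 then show ?thesis by (simp add: sgn_approx_def)
  next
    case 3
    then have "0 < - u" "- u \<le> 1" using assms by auto
    from pos[OF this] show ?thesis using 3 by (simp add: sgn_approx_minus) argo
  qed
  then show "\<bar>sgn u - sgn_approx m u\<bar> \<le> 1 - (sgn_approx m u)\<^sup>2" "\<bar>sgn_approx m u\<bar> \<le> 1"
    by blast+
qed

section \<open>Fourier expansion of \<open>sgn_approx m (sin \<theta>)\<close>\<close>

lemma cos_odd_power:
  fixes \<theta> :: real
  shows "4 ^ m * cos \<theta> ^ (2 * m + 1) = (\<Sum>j\<le>m. real (2 * m + 1 choose (m - j)) * cos ((2 * real j + 1) * \<theta>))"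
proof -
  let ?N = "2 * m + 1"
  \<comment> \<open>The indices m - j and m + 1 + j carry the opposite frequencies -(2j + 1) and 2j
    + 1 and equal binomial coefficients, so the two halves of the binomial sum agree.\<close>
  define f where "f i = real (?N choose i) * cos ((2 * real i - real ?N) * \<theta>)" for i
  have "complex_of_real (2 * cos \<theta>) ^ ?N = (cis \<theta> + cis (- \<theta>)) ^ ?N"
    by (simp add: complex_eq_iff)
  also have "\<dots> = (\<Sum>i\<le>?N. of_nat (?N choose i) * cis \<theta> ^ i * cis (- \<theta>) ^ (?N - i))"
    by (rule binomial_ring)
  also have "\<dots> = (\<Sum>i\<le>?N. of_nat (?N choose i) * cis ((2 * real i - real ?N) * \<theta>))"
  proof (intro sum.cong refl)
    fix i assume "i \<in> {..?N}"
    then have "cis \<theta> ^ i * cis (- \<theta>) ^ (?N - i) = cis ((2 * real i - real ?N) * \<theta>)"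
      by (simp only: Complex.DeMoivre cis_mult) (simp add: of_nat_diff algebra_simps)
    then show "of_nat (?N choose i) * cis \<theta> ^ i * cis (- \<theta>) ^ (?N - i) =
      of_nat (?N choose i) * cis ((2 * real i - real ?N) * \<theta>)" by (simp add: mult.assoc)
  qed
  finally have "Re (complex_of_real ((2 * cos \<theta>) ^ ?N)) = (\<Sum>i\<le>?N. f i)"
    by (simp only: of_real_power Re_sum) (simp add: f_def)
  then have "(2 * cos \<theta>) ^ ?N = (\<Sum>i\<le>?N. f i)" by simp
  also have "(\<Sum>i\<le>?N. f i) = (\<Sum>i\<le>m. f i) + (\<Sum>i\<in>{m + 1..?N}. f i)"
  proof -
    have "{..?N} = {..m} \<union> {m + 1..?N}" by auto
    then show ?thesis by (simp add: sum.union_disjoint ivl_disj_int)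
  qed
  also have "(\<Sum>i\<le>m. f i) = (\<Sum>j\<le>m. f (m - j))"
    by (rule sum.reindex_bij_witness[of _ "\<lambda>j. m - j" "\<lambda>j. m - j"]) auto
  also have "(\<Sum>j\<le>m. f (m - j)) = (\<Sum>j\<le>m. real (?N choose (m - j)) * cos ((2 * real j + 1) * \<theta>))"
  proof (intro sum.cong refl)
    fix j assume "j \<in> {..m}"
    then have "(2 * real (m - j) - real ?N) * \<theta> = - ((2 * real j + 1) * \<theta>)"
      by (simp add: of_nat_diff algebra_simps)
    then show "f (m - j) = real (?N choose (m - j)) * cos ((2 * real j + 1) * \<theta>)"
      by (simp only: f_def cos_minus)
  qed
  also have "(\<Sum>i\<in>{m + 1..?N}. f i) = (\<Sum>j\<le>m. f (m + 1 + j))"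
    by (rule sum.reindex_bij_witness[of _ "\<lambda>j. m + 1 + j" "\<lambda>i. i - (m + 1)"]) auto
  also have "(\<Sum>j\<le>m. f (m + 1 + j)) = (\<Sum>j\<le>m. real (?N choose (m - j)) * cos ((2 * real j + 1) * \<theta>))"
  proof (intro sum.cong refl)
    fix j assume j: "j \<in> {..m}"
    have "(?N choose (m + 1 + j)) = (?N choose (?N - (m + 1 + j)))"
      using j by (intro binomial_symmetric) auto
    then have "(?N choose (m + 1 + j)) = (?N choose (m - j))" by simp
    moreover have "2 * real (m + 1 + j) - real ?N = 2 * real j + 1" by simp
    ultimately show "f (m + 1 + j) = real (?N choose (m - j)) * cos ((2 * real j + 1) * \<theta>)"
      by (simp only: f_def)
  qed
  finally have "(2 * cos \<theta>) ^ ?N = 2 * (\<Sum>j\<le>m. real (?N choose (m - j)) * cos ((2 * real j + 1) * \<theta>))"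
    by (simp only: mult_2)
  moreover have "(2::real) ^ ?N = 2 * 4 ^ m" by (simp add: power_mult)
  then have "(2 * cos \<theta>) ^ ?N = 2 * (4 ^ m * cos \<theta> ^ ?N)"
    by (simp only: power_mult_distrib mult.assoc)
  ultimately show ?thesis by linarith
qed

text \<open>Obtained by integrating the derivative term by term: one factor 4^m comes from
  \<open>sgn_approx_has_derivative\<close>, the other from \<open>cos_odd_power\<close>, and 2j + 1
  from integrating the cosine.\<close>

definition fourier_coeff :: "nat \<Rightarrow> nat \<Rightarrow> real" where
  "fourier_coeff m j = (2 * real m + 1) * real (2 * m choose m) * real (2 * m + 1 choose (m - j))
     / ((2 * real j + 1) * 16 ^ m)"

text \<open>Both sides vanish at 0 and have the same derivative, a multiple of cos^(2m+1), by the
  chain rule and \<open>cos_odd_power\<close>.\<close>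

lemma sgn_approx_sin:
  "sgn_approx m (sin \<theta>) = (\<Sum>j\<le>m. fourier_coeff m j * sin ((2 * real j + 1) * \<theta>))"
proof -
  define h where "h \<theta> = sgn_approx m (sin \<theta>) - (\<Sum>j\<le>m. fourier_coeff m j * sin ((2 * real j + 1) * \<theta>))" for \<theta>
  define \<kappa> where "\<kappa> = (2 * real m + 1) * real (2 * m choose m)"
  have "(h has_real_derivative 0) (at x)" for x
  proof -
    have 1: "((\<lambda>\<theta>. sgn_approx m (sin \<theta>)) has_real_derivative
        (\<kappa> / 4 ^ m * (1 - (sin x)\<^sup>2) ^ m) * cos x) (at x)"
      unfolding \<kappa>_def by (rule DERIV_chain2[OF sgn_approx_has_derivative DERIV_sin])
    have 2: "((\<lambda>\<theta>. \<Sum>j\<le>m. fourier_coeff m j * sin ((2 * real j + 1) * \<theta>)) has_real_derivative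
        (\<Sum>j\<le>m. fourier_coeff m j * ((2 * real j + 1) * cos ((2 * real j + 1) * x)))) (at x)"
      by (auto intro!: derivative_eq_intros DERIV_sum sum.cong simp: mult_ac)
    have "(\<Sum>j\<le>m. fourier_coeff m j * ((2 * real j + 1) * cos ((2 * real j + 1) * x)))
      = (\<Sum>j\<le>m. \<kappa> / 16 ^ m * (real (2 * m + 1 choose (m - j)) * cos ((2 * real j + 1) * x)))"
    proof (intro sum.cong refl)
      fix j
      have "2 * real j + 1 \<noteq> 0" by linarith
      then show "fourier_coeff m j * ((2 * real j + 1) * cos ((2 * real j + 1) * x)) =
         \<kappa> / 16 ^ m * (real (2 * m + 1 choose (m - j)) * cos ((2 * real j + 1) * x))"
        by (simp add: fourier_coeff_def \<kappa>_def divide_simps)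
    qed
    also have "\<dots> = \<kappa> / 16 ^ m * (4 ^ m * cos x ^ (2 * m + 1))"
      by (simp only: cos_odd_power sum_distrib_left)
    also have "\<dots> = (\<kappa> / 4 ^ m * (1 - (sin x)\<^sup>2) ^ m) * cos x"
    proof -
      have "(16::real) ^ m = 4 ^ m * 4 ^ m" by (simp flip: power_mult_distrib)
      then show ?thesis
        by (simp add: cos_squared_eq[symmetric] power_mult)
    qed
    finally show ?thesis
      using DERIV_diff[OF 1 2] by (simp add: h_def[abs_def])
  qed
  then have "h \<theta> = h 0" using DERIV_isconst_all by blast
  also have "h 0 = 0" by (simp add: h_def sgn_approx_def)
  finally show ?thesis by (simp add: h_def)
qed

section \<open>The inverse squares of the odd numbers and the bound pi^2 < 10\<close>

lemma odd_inverse_squares_sums: "(\<lambda>j. 1 / (2 * real j + 1)\<^sup>2) sums (pi\<^sup>2 / 8)"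
proof -
  define f where "f n = 1 / (real n + 1)\<^sup>2" for n
  have f: "f sums (pi\<^sup>2 / 6)" using inverse_squares_sums by (simp add: f_def[abs_def] add.commute)
  \<comment> \<open>Among the first 2N inverse squares, those of even numbers make up a quarter of
    the first N. The limit is therefore pi^2 / 6 - pi^2 / 24.\<close>
  have split: "(\<Sum>j<N. 1 / (2 * real j + 1)\<^sup>2) = (\<Sum>n<N * 2. f n) - (\<Sum>n<N. f n) / 4" for N
  proof (induction N)
    case (Suc N)
    have "f N = 4 * f (Suc (N * 2))"
      by (simp add: f_def divide_simps) (simp add: power2_eq_square algebra_simps)
    moreover have "f (N * 2) = 1 / (2 * real N + 1)\<^sup>2" by (simp add: f_def mult.commute)
    ultimately show ?case using Suc by (simp add: add_divide_distrib)
  qed simp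
  have lim: "(\<lambda>N. \<Sum>n<N. f n) \<longlonglongrightarrow> pi\<^sup>2 / 6" using f by (simp add: sums_def)
  have "(\<lambda>N. \<Sum>n<N * 2. f n) \<longlonglongrightarrow> pi\<^sup>2 / 6"
    using LIMSEQ_linear[OF lim, of 2] by simp
  then have "(\<lambda>N. (\<Sum>n<N * 2. f n) - (\<Sum>n<N. f n) / 4) \<longlonglongrightarrow> pi\<^sup>2 / 6 - pi\<^sup>2 / 6 / 4"
    by (intro tendsto_diff tendsto_divide lim) auto
  then show ?thesis by (simp add: sums_def split)
qed

lemma odd_inverse_squares_le: "(\<Sum>j<N. 1 / (2 * real j + 1)\<^sup>2) \<le> pi\<^sup>2 / 8"
  using odd_inverse_squares_sums
  by (metis sum_le_suminf sums_unique sums_summable finite_lessThan zero_le_divide_1_iff zero_le_power2)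

text \<open>Exactly what makes 1 - 20 / (3 pi^2) smaller than 1/3. Three terms of the series are
  kept; from j = 3 on, 1 / (2j + 1)^2 \<le> 1 / (4j) - 1 / (4(j + 1)) telescopes to at most
  1/12.\<close>

lemma pi_square_less_10: "pi\<^sup>2 < 10"
proof -
  have bound: "(\<Sum>j<N + 3. 1 / (2 * real j + 1)\<^sup>2) \<le> 1 + 1/9 + 1/25 + 1/12 - 1 / (4 * real (N + 3))" for N
  proof (induction N)
    case 0
    have "(\<Sum>j<3. 1 / (2 * real j + 1)\<^sup>2) = 1 + 1/9 + 1/25"
      by (simp add: numeral_3_eq_3)
    then show ?case by simp
  next
    case (Suc N)
    define x where "x = real N + 3"
    have x: "x > 0" by (simp add: x_def)
    have "1 / (2 * x + 1)\<^sup>2 \<le> 1 / (4 * x * (x + 1))"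
      using x by (intro divide_left_mono) (auto simp: power2_eq_square algebra_simps intro!: add_pos_pos mult_pos_pos)
    also have "\<dots> = 1 / (4 * x) - 1 / (4 * (x + 1))"
      using x by (simp add: field_simps)
    finally have "1 / (2 * x + 1)\<^sup>2 \<le> 1 / (4 * x) - 1 / (4 * (x + 1))" .
    moreover have "(\<Sum>j<Suc N + 3. 1 / (2 * real j + 1)\<^sup>2) = (\<Sum>j<N + 3. 1 / (2 * real j + 1)\<^sup>2) + 1 / (2 * x + 1)\<^sup>2"
      by (simp only: add_Suc sum.lessThan_Suc) (simp add: x_def)
    moreover have "real (N + 3) = x" "real (Suc N + 3) = x + 1" by (simp_all add: x_def)
    ultimately show ?case using Suc by (simp only:)
  qed
  have "(\<lambda>N. \<Sum>j<N + 3. 1 / (2 * real j + 1)\<^sup>2) \<longlonglongrightarrow> pi\<^sup>2 / 8"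
    using odd_inverse_squares_sums unfolding sums_def by (rule LIMSEQ_ignore_initial_segment)
  then have "pi\<^sup>2 / 8 \<le> 1 + 1/9 + 1/25 + 1/12"
  proof (rule LIMSEQ_le_const2)
    have "(\<Sum>j<N + 3. 1 / (2 * real j + 1)\<^sup>2) \<le> 1 + 1/9 + 1/25 + 1/12" for N
    proof -
      have "0 \<le> 1 / (4 * real (N + 3))" by simp
      then show ?thesis using bound[of N] by linarith
    qed
    then show "\<exists>M. \<forall>N\<ge>M. (\<Sum>j<N + 3. 1 / (2 * real j + 1)\<^sup>2) \<le> 1 + 1/9 + 1/25 + 1/12" by blast
  qed
  then show ?thesis by simp
qed

section \<open>Size and limits of the Fourier coefficients\<close>

lemma fourier_coeff_0_Suc:
  "fourier_coeff (Suc m) 0 = fourier_coeff m 0 * ((2 * real m + 3)\<^sup>2 / (4 * (real m + 1) * (real m + 2)))"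
proof -
  have coeff: "fourier_coeff m 0 = (2 * real m + 1)\<^sup>2 / (real m + 1) * (real (2 * m choose m))\<^sup>2 / 16 ^ m" for m
  proof -
    have "Suc m * (2 * m + 1 choose m) = (2 * m + 1) * (2 * m choose m)"
    proof -
      have "(2 * m + 1 choose m) = (2 * m + 1 choose Suc m)" by (subst binomial_symmetric) auto
      then show ?thesis using Suc_times_binomial_eq[of "2 * m" m] by (simp add: mult.commute)
    qed
    then have "real (Suc m * (2 * m + 1 choose m)) = real ((2 * m + 1) * (2 * m choose m))" by (simp only:)
    then have "real (2 * m + 1 choose m) = (2 * real m + 1) * real (2 * m choose m) / (real m + 1)"
      unfolding of_nat_mult by (simp add: divide_simps mult.commute del: binomial_Suc_Suc) (simp add: algebra_simps)
    then show ?thesis by (simp add: fourier_coeff_def power2_eq_square)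
  qed
  define X Y where "X = real (2 * Suc m choose Suc m)" and "Y = real (2 * m choose m)"
  have "X = 2 * (2 * real m + 1) * Y / (real m + 1)"
    using central_binomial_Suc[of m, folded X_def Y_def] by (simp add: divide_simps mult_ac add_ac)
  then have "fourier_coeff (Suc m) 0 = (2 * real m + 3)\<^sup>2 / (real m + 2) * (2 * (2 * real m + 1) * Y / (real m + 1))\<^sup>2 / (16 * 16 ^ m)"
    unfolding coeff X_def[symmetric] by (simp add: add_ac)
  also have "\<dots> = (2 * real m + 1)\<^sup>2 / (real m + 1) * Y\<^sup>2 / 16 ^ m * ((2 * real m + 3)\<^sup>2 / (4 * (real m + 1) * (real m + 2)))"
    by (simp add: power2_eq_square divide_simps) (simp add: algebra_simps)
  finally show ?thesis unfolding coeff Y_def by simp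
qed

lemma fourier_coeff_0_pos: "fourier_coeff m 0 > 0"
  by (simp add: fourier_coeff_def)

text \<open>The product with the m-th Wallis product is exactly (2m + 1) / (m + 1), which tends to
  2, while the Wallis product tends to pi / 2.\<close>

lemma fourier_coeff_0_tendsto: "(\<lambda>m. fourier_coeff m 0) \<longlonglongrightarrow> 4 / pi"
proof -
  define W where "W m = (\<Prod>k=1..m. (4 * real k ^ 2) / (4 * real k ^ 2 - 1))" for m
  have W0: "W m > 0" for m
    unfolding W_def
  proof (intro prod_pos ballI divide_pos_pos)
    fix k assume "k \<in> {1..m}"
    then have "1 \<le> (real k)\<^sup>2" by (intro one_le_power) auto
    then show "0 < 4 * (real k)\<^sup>2" "0 < 4 * (real k)\<^sup>2 - 1" by linarith+
  qed
  have step: "W (Suc m) = W m * (4 * (real m + 1)\<^sup>2 / ((2 * real m + 1) * (2 * real m + 3)))" for m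
    by (simp add: W_def power2_eq_square algebra_simps)
  have prod: "fourier_coeff m 0 * W m = (2 * real m + 1) / (real m + 1)" for m
  proof (induction m)
    case 0
    then show ?case by (simp add: W_def fourier_coeff_def)
  next
    case (Suc m)
    have "fourier_coeff (Suc m) 0 * W (Suc m) = (fourier_coeff m 0 * W m) *
      ((2 * real m + 3)\<^sup>2 / (4 * (real m + 1) * (real m + 2)) * (4 * (real m + 1)\<^sup>2 / ((2 * real m + 1) * (2 * real m + 3))))"
      by (simp only: fourier_coeff_0_Suc step mult_ac)
    also have "\<dots> = (2 * real (Suc m) + 1) / (real (Suc m) + 1)"
      unfolding Suc by (simp add: power2_eq_square divide_simps add_nonneg_eq_0_iff) (simp add: algebra_simps)
    finally show ?case .
  qed
  have "fourier_coeff m 0 = (2 * real m + 1) / (real m + 1) / W m" for m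
    using prod[of m] W0[of m] by (metis nonzero_mult_div_cancel_right less_irrefl)
  moreover have "(\<lambda>m. (2 * real m + 1) / (real m + 1)) \<longlonglongrightarrow> 2"
    by real_asymp
  then have "(\<lambda>m. (2 * real m + 1) / (real m + 1) / W m) \<longlonglongrightarrow> 2 / (pi / 2)"
    using wallis by (intro tendsto_divide) (auto simp: W_def[abs_def])
  ultimately show ?thesis by simp
qed

text \<open>The ratio in \<open>fourier_coeff_0_Suc\<close> is at least 1, as its numerator exceeds
  its denominator by 1. So the coefficients increase to their limit.\<close>

lemma fourier_coeff_0_le: "fourier_coeff m 0 \<le> 4 / pi"
proof (rule incseq_le[OF _ fourier_coeff_0_tendsto])
  show "incseq (\<lambda>m. fourier_coeff m 0)"
  proof (rule incseq_SucI)
    fix m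
    have "1 \<le> (2 * real m + 3)\<^sup>2 / (4 * (real m + 1) * (real m + 2))"
      by (subst le_divide_eq_1_pos) (auto simp: power2_eq_square algebra_simps intro!: add_pos_nonneg)
    from mult_left_mono[OF this less_imp_le[OF fourier_coeff_0_pos[of m]]]
    show "fourier_coeff m 0 \<le> fourier_coeff (Suc m) 0"
      by (simp only: fourier_coeff_0_Suc mult_1_right)
  qed
qed

lemma fourier_coeff_eq:
  "fourier_coeff m j = fourier_coeff m 0 *
     (real (2 * m + 1 choose (m - j)) / real (2 * m + 1 choose m)) / (2 * real j + 1)"
  by (simp add: fourier_coeff_def mult_ac del: binomial_Suc_Suc)

lemma fourier_coeff_bounds: "0 \<le> fourier_coeff m j" "fourier_coeff m j \<le> 4 / pi / (2 * real j + 1)"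
proof -
  show "0 \<le> fourier_coeff m j" by (simp add: fourier_coeff_def)
  have "(2 * m + 1 choose (m - j)) \<le> (2 * m + 1 choose m)"
    by (rule binomial_mono) auto
  then have "real (2 * m + 1 choose (m - j)) / real (2 * m + 1 choose m) \<le> 1"
    by (simp add: divide_le_eq_1 del: binomial_Suc_Suc)
  then have "fourier_coeff m 0 * (real (2 * m + 1 choose (m - j)) / real (2 * m + 1 choose m)) \<le> 4 / pi * 1"
    by (intro mult_mono fourier_coeff_0_le) auto
  then show "fourier_coeff m j \<le> 4 / pi / (2 * real j + 1)"
    unfolding fourier_coeff_eq[of m j] by (intro divide_right_mono) auto
qed

text \<open>For fixed j, neighbouring binomial coefficients near the centre have ratio (m - j) / (m
  + j + 2), which tends to 1. The limits are the sine coefficients of the square wave.\<close>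

lemma fourier_coeff_tendsto: "(\<lambda>m. fourier_coeff m j) \<longlonglongrightarrow> 4 / pi / (2 * real j + 1)"
proof -
  have "(\<lambda>m. real (2 * m + 1 choose (m - j)) / real (2 * m + 1 choose m)) \<longlonglongrightarrow> 1"
  proof (induction j)
    case 0
    have "(\<lambda>m. real (2 * m + 1 choose (m - 0)) / real (2 * m + 1 choose m)) = (\<lambda>m. 1)"
      by (simp add: fun_eq_iff del: binomial_Suc_Suc)
    then show ?case by simp
  next
    case (Suc j)
    have "(\<lambda>m. (real m - real j) / (real m + real j + 2)) \<longlonglongrightarrow> 1" by real_asymp
    from tendsto_mult[OF Suc this]
    have lim: "(\<lambda>m. real (2 * m + 1 choose (m - j)) / real (2 * m + 1 choose m) * ((real m - real j) / (real m + real j + 2))) \<longlonglongrightarrow> 1"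
      by (simp del: binomial_Suc_Suc)
    have "\<forall>\<^sub>F m in sequentially.
        real (2 * m + 1 choose (m - j)) / real (2 * m + 1 choose m) * ((real m - real j) / (real m + real j + 2))
        = real (2 * m + 1 choose (m - Suc j)) / real (2 * m + 1 choose m)"
    proof (rule eventually_sequentiallyI[of "Suc j"])
      fix m assume m: "Suc j \<le> m"
      define k where "k = m - Suc j"
      have k: "m - j = Suc k" "m = k + Suc j" using m by (auto simp: k_def)
      have "Suc k * (2 * m + 1 choose Suc k) = (2 * m + 1 - k) * (2 * m + 1 choose k)"
        using binomial_absorption[of k "2 * m + 1"] binomial_absorb_comp[of "2 * m + 1" k] by simp
      then have "real (Suc k * (2 * m + 1 choose Suc k)) = real ((2 * m + 1 - k) * (2 * m + 1 choose k))"
        by (simp only:)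
      then have "real (2 * m + 1 choose (m - j)) * (real m - real j) = real (2 * m + 1 choose k) * (real m + real j + 2)"
        using k by (simp add: of_nat_diff mult.commute algebra_simps del: binomial_Suc_Suc)
      then have "real (2 * m + 1 choose (m - j)) * (real m - real j) / (real m + real j + 2) = real (2 * m + 1 choose k)"
        by (simp add: divide_simps)
      then show "real (2 * m + 1 choose (m - j)) / real (2 * m + 1 choose m) * ((real m - real j) / (real m + real j + 2))
        = real (2 * m + 1 choose (m - Suc j)) / real (2 * m + 1 choose m)"
        unfolding k_def by (simp add: divide_divide_eq_left' mult.commute del: binomial_Suc_Suc)
    qed
    then show ?case using lim by (rule Lim_transform_eventually[rotated])
  qed
  then have "(\<lambda>m. fourier_coeff m 0 * (real (2 * m + 1 choose (m - j)) / real (2 * m + 1 choose m)) / (2 * real j + 1))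
    \<longlonglongrightarrow> 4 / pi * 1 / (2 * real j + 1)"
    by (intro tendsto_intros fourier_coeff_0_tendsto) auto
  then show ?thesis by (subst fourier_coeff_eq) simp
qed

text \<open>By Parseval half the sum of squares is the mean square of the polynomial. A finite
  number J of limiting coefficients is fixed first, then m is taken large. The condition m \<ge> 1
  serves \<open>odd_multiples_sum_le_nonzero\<close>.\<close>

lemma exists_fourier_coeff_square_sum:
  assumes "\<epsilon> > 0"
  shows "\<exists>m\<ge>1. (\<Sum>j\<le>m. (fourier_coeff m j)\<^sup>2) / 2 > 1 - \<epsilon>"
proof -
  have "(\<lambda>J. 8 / pi\<^sup>2 * (\<Sum>j<J. 1 / (2 * real j + 1)\<^sup>2)) \<longlonglongrightarrow> 8 / pi\<^sup>2 * (pi\<^sup>2 / 8)"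
    using odd_inverse_squares_sums by (intro tendsto_mult tendsto_const) (simp add: sums_def)
  then have "(\<lambda>J. 8 / pi\<^sup>2 * (\<Sum>j<J. 1 / (2 * real j + 1)\<^sup>2)) \<longlonglongrightarrow> 1" by simp
  then have "\<forall>\<^sub>F J in sequentially. 1 - \<epsilon> < 8 / pi\<^sup>2 * (\<Sum>j<J. 1 / (2 * real j + 1)\<^sup>2)"
    using assms by (intro order_tendstoD(1)) auto
  then obtain J where J: "1 - \<epsilon> < 8 / pi\<^sup>2 * (\<Sum>j<J. 1 / (2 * real j + 1)\<^sup>2)"
    by (auto simp: eventually_sequentially)
  have "(\<lambda>m. (\<Sum>j<J. (fourier_coeff m j)\<^sup>2) / 2) \<longlonglongrightarrow> (\<Sum>j<J. (4 / pi / (2 * real j + 1))\<^sup>2) / 2"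
    by (intro tendsto_intros fourier_coeff_tendsto) auto
  also have "(\<Sum>j<J. (4 / pi / (2 * real j + 1))\<^sup>2) / 2 = 8 / pi\<^sup>2 * (\<Sum>j<J. 1 / (2 * real j + 1)\<^sup>2)"
    by (simp add: sum_distrib_left sum_divide_distrib power_divide power_mult_distrib)
  finally have "\<forall>\<^sub>F m in sequentially. 1 - \<epsilon> < (\<Sum>j<J. (fourier_coeff m j)\<^sup>2) / 2"
    using J by (rule order_tendstoD(1))
  moreover have "\<forall>\<^sub>F m in sequentially. m \<ge> max 1 J" by (rule eventually_ge_at_top)
  ultimately have "\<forall>\<^sub>F m in sequentially. m \<ge> max 1 J \<and> 1 - \<epsilon> < (\<Sum>j<J. (fourier_coeff m j)\<^sup>2) / 2"
    by eventually_elim auto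
  then obtain m where m: "m \<ge> max 1 J" "1 - \<epsilon> < (\<Sum>j<J. (fourier_coeff m j)\<^sup>2) / 2"
    by (auto simp: eventually_sequentially)
  have "(\<Sum>j<J. (fourier_coeff m j)\<^sup>2) \<le> (\<Sum>j\<le>m. (fourier_coeff m j)\<^sup>2)"
    using m(1) by (intro sum_mono2) auto
  then show ?thesis using m by (intro exI[of _ m]) auto
qed

section \<open>Correlations of the approximations over the units\<close>

definition unit_mean :: "nat \<Rightarrow> int \<Rightarrow> real" where
  "unit_mean n z = (\<Sum>g\<in>totatives n. cos (2 * pi * of_int (z * int g) / n)) / totient n"

lemma unit_mean_0: "n > 0 \<Longrightarrow> unit_mean n 0 = 1"
  by (simp add: unit_mean_def totient_def)

lemma abs_unit_mean_le_totient:
  assumes "n > 0"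
  shows "\<bar>unit_mean n z\<bar> \<le> 1 / totient (add_order n z)"
proof -
  have "(\<Sum>g\<in>totatives n. cos (2 * pi * of_int (z * int g) / n)) = Re (ramanujan_sum n z)"
    by (simp add: ramanujan_sum_def add_char_def)
  then have "\<bar>unit_mean n z\<bar> \<le> norm (ramanujan_sum n z) / totient n"
    using abs_Re_le_cmod[of "ramanujan_sum n z"] by (simp add: unit_mean_def divide_right_mono)
  also have "\<dots> \<le> 1 / totient (add_order n z)"
    using norm_ramanujan_sum_le[OF assms, of z] add_order_pos[OF assms, of z] assms
    by (simp add: divide_simps)
  finally show ?thesis .
qed

lemma abs_unit_mean_le_1:
  assumes "n > 0"
  shows "\<bar>unit_mean n z\<bar> \<le> 1"
proof -
  have "totient (add_order n z) \<ge> 1" using add_order_pos[OF assms, of z] by (simp add: Suc_le_eq)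
  then have "1 / real (totient (add_order n z)) \<le> 1" by (intro divide_le_eq_1[THEN iffD2]) auto
  then show ?thesis using abs_unit_mean_le_totient[OF assms, of z] by linarith
qed

text \<open>The additive order is a divisor of n other than 1, hence again coprime to 6, and its
  totient is at least 4.\<close>

lemma abs_unit_mean_le_quarter:
  assumes "gcd n 6 = 1" "\<not> int n dvd z"
  shows "\<bar>unit_mean n z\<bar> \<le> 1 / 4"
proof -
  have n: "n > 0" using assms(1) by (intro Nat.gr0I) auto
  have "add_order n z \<noteq> 1" using add_order_eq_1[OF n] assms(2) by blast
  moreover have "gcd (add_order n z) 6 = 1"
    using assms(1) add_order_dvd[of n z] by (metis coprime_divisors coprime_iff_gcd_eq_1 dvd_refl)
  ultimately have "totient (add_order n z) \<ge> 4" by (intro totient_ge_4)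
  then have "1 / real (totient (add_order n z)) \<le> 1 / 4"
    using add_order_pos[OF n, of z] by (intro divide_left_mono) auto
  then show ?thesis using abs_unit_mean_le_totient[OF n, of z] by linarith
qed

lemma abs_unit_mean_le_sqrt:
  assumes "odd n" "M > 0" "M \<le> add_order n z"
  shows "\<bar>unit_mean n z\<bar> \<le> 1 / sqrt M"
proof -
  have n: "n > 0" using assms(1) by (rule odd_pos)
  have "odd (add_order n z)" using assms(1) add_order_dvd[of n z] dvd_trans by blast
  then have "M \<le> totient (add_order n z) ^ 2" using le_totient_square assms(3) le_trans by blast
  then have "sqrt M \<le> totient (add_order n z)"
    by (intro real_le_lsqrt) (auto simp flip: of_nat_power)
  then have "1 / real (totient (add_order n z)) \<le> 1 / sqrt M"
    using assms(2) add_order_pos[OF n, of z] by (intro divide_left_mono) auto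
  then show ?thesis using abs_unit_mean_le_totient[OF n, of z] by linarith
qed

section \<open>Correlations and their expansion into frequencies\<close>

definition wave :: "nat \<Rightarrow> nat \<Rightarrow> int \<Rightarrow> real" where
  "wave m n z = sgn_approx m (sin (2 * pi * of_int z / n))"

definition corr :: "nat \<Rightarrow> nat \<Rightarrow> int \<Rightarrow> int \<Rightarrow> real" where
  "corr m n x y = (\<Sum>g\<in>totatives n. wave m n (x * int g) * wave m n (y * int g)) / totient n"

text \<open>Product-to-sum formula for two sines, averaged over the units; each pair of harmonics
  yields a difference and a sum frequency.\<close>

lemma corr_eq:
  "corr m n x y = (\<Sum>i\<le>m. \<Sum>j\<le>m. fourier_coeff m i * fourier_coeff m j / 2 *
     (unit_mean n ((2 * int i + 1) * x - (2 * int j + 1) * y) - unit_mean n ((2 * int i + 1) * x + (2 * int j + 1) * y)))"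
proof -
  have prod: "wave m n (x * int g) * wave m n (y * int g) =
    (\<Sum>i\<le>m. \<Sum>j\<le>m. fourier_coeff m i * fourier_coeff m j / 2 *
      (cos (2 * pi * of_int (((2 * int i + 1) * x - (2 * int j + 1) * y) * int g) / n) -
       cos (2 * pi * of_int (((2 * int i + 1) * x + (2 * int j + 1) * y) * int g) / n)))" for g
    unfolding wave_def sgn_approx_sin sum_product
  proof (intro sum.cong refl)
    fix i j
    define \<alpha> \<beta> where "\<alpha> = (2 * real i + 1) * (2 * pi * of_int (x * int g) / n)"
      and "\<beta> = (2 * real j + 1) * (2 * pi * of_int (y * int g) / n)"
    have ang: "2 * pi * of_int (((2 * int i + 1) * x - (2 * int j + 1) * y) * int g) / n = \<alpha> - \<beta>"
      "2 * pi * of_int (((2 * int i + 1) * x + (2 * int j + 1) * y) * int g) / n = \<alpha> + \<beta>"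
      by (simp_all add: \<alpha>_def \<beta>_def add_divide_distrib[symmetric] diff_divide_distrib[symmetric])
         (simp_all add: algebra_simps)
    show "fourier_coeff m i * sin \<alpha> * (fourier_coeff m j * sin \<beta>) =
      fourier_coeff m i * fourier_coeff m j / 2 *
      (cos (2 * pi * of_int (((2 * int i + 1) * x - (2 * int j + 1) * y) * int g) / n) -
       cos (2 * pi * of_int (((2 * int i + 1) * x + (2 * int j + 1) * y) * int g) / n))"
      unfolding ang using sin_times_sin[of \<alpha> \<beta>] by simp
  qed
  have lift: "(\<Sum>i\<le>m. \<Sum>j\<le>m. c i j * (A i j - B i j)) / T = (\<Sum>i\<le>m. \<Sum>j\<le>m. c i j * (A i j / T - B i j / T))"
    for c A B :: "nat \<Rightarrow> nat \<Rightarrow> real" and T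
    by (simp add: sum_divide_distrib diff_divide_distrib right_diff_distrib)
  have "(\<Sum>g\<in>totatives n. wave m n (x * int g) * wave m n (y * int g)) =
    (\<Sum>i\<le>m. \<Sum>j\<le>m. \<Sum>g\<in>totatives n. fourier_coeff m i * fourier_coeff m j / 2 *
      (cos (2 * pi * of_int (((2 * int i + 1) * x - (2 * int j + 1) * y) * int g) / n) -
       cos (2 * pi * of_int (((2 * int i + 1) * x + (2 * int j + 1) * y) * int g) / n)))"
    unfolding prod by (subst sum.swap) (intro sum.cong refl sum.swap)
  then show ?thesis
    unfolding corr_def unit_mean_def by (simp only: sum_distrib_left[symmetric] sum_subtractf lift)
qed

text \<open>The difference frequency vanishes for i = j, which gives the Parseval sum. All other
  frequencies are multiples kx with 0 < |k| \<le> 2(2m + 1); since x is a unit and n is large, their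
  order is at least M.\<close>

lemma corr_self_ge:
  assumes "odd n" "coprime x (int n)" "M > 0" "n > 2 * M * (2 * m + 1)"
  shows "corr m n x x \<ge> (\<Sum>j\<le>m. (fourier_coeff m j)\<^sup>2) / 2 - 4 * (real m + 1)\<^sup>2 / sqrt M"
proof -
  have n: "n > 0" using assms(1) by (rule odd_pos)
  have small: "\<bar>unit_mean n (k * x)\<bar> \<le> 1 / sqrt M" if "k \<noteq> 0" "\<bar>k\<bar> \<le> 2 * int (2 * m + 1)" for k
  proof (rule abs_unit_mean_le_sqrt[OF assms(1,3)])
    show "M \<le> add_order n (k * x)"
    proof (rule ccontr)
      assume "\<not> M \<le> add_order n (k * x)"
      then have less: "int (add_order n (k * x)) \<le> int M" by simp
      have "int n dvd (int (add_order n (k * x)) * k) * x"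
        using dvd_add_order_mult[of n "k * x"] by (simp add: mult.assoc)
      then have "int n dvd int (add_order n (k * x)) * k"
        using assms(2) by (simp add: coprime_dvd_mult_left_iff coprime_commute)
      then have "int n \<le> \<bar>int (add_order n (k * x)) * k\<bar>"
        using that(1) add_order_pos[OF n, of "k * x"] by (intro zdvd_imp_le) auto
      also have "\<dots> \<le> int M * (2 * int (2 * m + 1))"
        unfolding abs_mult using that(2) less by (intro mult_mono) auto
      also have "\<dots> = int (2 * M * (2 * m + 1))" by (simp add: algebra_simps)
      finally show False using assms(4) by linarith
    qed
  qed
  have a: "0 \<le> fourier_coeff m i" "fourier_coeff m i \<le> 2" for i
  proof -
    show "0 \<le> fourier_coeff m i" by (rule fourier_coeff_bounds)
    have "4 / pi / (2 * real i + 1) \<le> 4 / pi / 1" by (intro divide_left_mono) auto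
    also have "\<dots> \<le> 2" using pi_ge_two by (simp add: divide_simps)
    finally show "fourier_coeff m i \<le> 2" using fourier_coeff_bounds(2)[of m i] by linarith
  qed
  \<comment> \<open>Coefficients are at most 4 / pi \<le> 2, so the factor in front is at most 2; it
    multiplies two errors of size 1 / sqrt M.\<close>
  have entry: "(if i = j then (fourier_coeff m i)\<^sup>2 / 2 else 0) - 4 / sqrt M \<le>
     fourier_coeff m i * fourier_coeff m j / 2 *
     (unit_mean n ((2 * int i + 1) * x - (2 * int j + 1) * x) - unit_mean n ((2 * int i + 1) * x + (2 * int j + 1) * x))"
    if "i \<le> m" "j \<le> m" for i j
  proof -
    define c where "c = fourier_coeff m i * fourier_coeff m j / 2"
    have "fourier_coeff m i * fourier_coeff m j \<le> 2 * 2" using a by (intro mult_mono) auto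
    then have c: "0 \<le> c" "c \<le> 2" using a by (auto simp: c_def)
    have "(2 * int i + 1) * x + (2 * int j + 1) * x = (2 * int i + 1 + (2 * int j + 1)) * x"
      by (simp add: algebra_simps)
    then have plus: "\<bar>unit_mean n ((2 * int i + 1) * x + (2 * int j + 1) * x)\<bar> \<le> 1 / sqrt M"
      using that by (simp only:) (intro small, auto)
    have minus: "(if i = j then 1 else 0) - 1 / sqrt M \<le> unit_mean n ((2 * int i + 1) * x - (2 * int j + 1) * x)"
    proof (cases "i = j")
      case True
      then show ?thesis using unit_mean_0[OF n] by simp
    next
      case False
      have "(2 * int i + 1) * x - (2 * int j + 1) * x = (2 * (int i - int j)) * x"
        by (simp add: algebra_simps)
      then have "\<bar>unit_mean n ((2 * int i + 1) * x - (2 * int j + 1) * x)\<bar> \<le> 1 / sqrt M"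
        using that False by (simp only:) (intro small, auto)
      then show ?thesis using False by simp
    qed
    have "c * ((if i = j then 1 else 0) - 2 / sqrt M) \<le> c *
      (unit_mean n ((2 * int i + 1) * x - (2 * int j + 1) * x) - unit_mean n ((2 * int i + 1) * x + (2 * int j + 1) * x))"
      using plus minus c(1) by (intro mult_left_mono) auto
    moreover have "c * (2 / sqrt M) \<le> 2 * (2 / sqrt M)" using c(2) by (intro mult_right_mono) auto
    moreover have "(if i = j then (fourier_coeff m i)\<^sup>2 / 2 else 0) = c * (if i = j then 1 else 0)"
      by (simp add: c_def power2_eq_square)
    ultimately show ?thesis
      unfolding c_def[symmetric] by (simp only: right_diff_distrib)
  qed
  have "(\<Sum>i\<le>m. \<Sum>j\<le>m. (if i = j then (fourier_coeff m i)\<^sup>2 / 2 else 0) - 4 / sqrt M) \<le> corr m n x x"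
    unfolding corr_eq by (intro sum_mono entry) auto
  also have "(\<Sum>i\<le>m. \<Sum>j\<le>m. (if i = j then (fourier_coeff m i)\<^sup>2 / 2 else 0) - 4 / sqrt M) =
    (\<Sum>j\<le>m. (fourier_coeff m j)\<^sup>2) / 2 - 4 * (real m + 1)\<^sup>2 / sqrt M"
    by (simp add: sum_subtractf sum.delta sum_divide_distrib power2_eq_square) (simp add: algebra_simps)
  finally show ?thesis .
qed

section \<open>Odd frequencies and those of small additive order\<close>

definition odds :: "nat \<Rightarrow> int set" where
  "odds m = (\<lambda>i. 2 * int i + 1) ` {..m}"

lemma odds_iff: "k \<in> odds m \<longleftrightarrow> odd k \<and> 0 < k \<and> k \<le> 2 * int m + 1"
proof
  assume k: "odd k \<and> 0 < k \<and> k \<le> 2 * int m + 1"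
  then obtain i where i: "k = 2 * i + 1" by (auto elim: oddE)
  then have "nat i \<le> m" "k = 2 * int (nat i) + 1" using k by auto
  then show "k \<in> odds m" unfolding odds_def by blast
qed (auto simp: odds_def)

lemma sum_odds: "(\<Sum>k\<in>odds m. f k) = (\<Sum>i\<le>m. f (2 * int i + 1))"
  unfolding odds_def by (subst sum.reindex) (auto simp: inj_on_def)

lemma finite_odds [simp]: "finite (odds m)" and card_odds [simp]: "card (odds m) = m + 1"
  by (auto simp: odds_def card_image inj_on_def)

text \<open>Sum and difference frequencies are merged into one sum by letting l take both signs
  while k stays positive.\<close>

lemma abs_corr_le_frequencies:
  "\<bar>corr m n x y\<bar> \<le> 8 / pi\<^sup>2 * (\<Sum>(k, l)\<in>odds m \<times> (odds m \<union> uminus ` odds m).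
      \<bar>unit_mean n (k * x + l * y)\<bar> / (real_of_int k * \<bar>real_of_int l\<bar>))"
proof -
  define h where "h k l = \<bar>unit_mean n (k * x + l * y)\<bar> / (real_of_int k * \<bar>real_of_int l\<bar>)" for k l
  have coeff: "fourier_coeff m i * fourier_coeff m j / 2 \<le> 8 / pi\<^sup>2 / ((2 * real i + 1) * (2 * real j + 1))" for i j
  proof -
    have "fourier_coeff m i * fourier_coeff m j \<le> (4 / pi / (2 * real i + 1)) * (4 / pi / (2 * real j + 1))"
      by (intro mult_mono fourier_coeff_bounds) auto
    then show ?thesis by (simp add: power2_eq_square mult_ac)
  qed
  have entry: "\<bar>fourier_coeff m i * fourier_coeff m j / 2 *
     (unit_mean n ((2 * int i + 1) * x - (2 * int j + 1) * y) - unit_mean n ((2 * int i + 1) * x + (2 * int j + 1) * y))\<bar>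
     \<le> 8 / pi\<^sup>2 * (h (2 * int i + 1) (2 * int j + 1) + h (2 * int i + 1) (- (2 * int j + 1)))" for i j
  proof -
    define u v where "u = unit_mean n ((2 * int i + 1) * x - (2 * int j + 1) * y)"
      and "v = unit_mean n ((2 * int i + 1) * x + (2 * int j + 1) * y)"
    define p where "p = (2 * real i + 1) * (2 * real j + 1)"
    have "p > 0" by (simp add: p_def add_pos_nonneg)
    have "\<bar>fourier_coeff m i * fourier_coeff m j / 2 * (u - v)\<bar> = fourier_coeff m i * fourier_coeff m j / 2 * \<bar>u - v\<bar>"
      using fourier_coeff_bounds(1)[of m i] fourier_coeff_bounds(1)[of m j] by (simp add: abs_mult)
    also have "\<dots> \<le> 8 / pi\<^sup>2 / p * (\<bar>u\<bar> + \<bar>v\<bar>)"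
      unfolding p_def using coeff[of i j] \<open>p > 0\<close> by (intro mult_mono) (auto simp: p_def)
    also have "\<dots> = 8 / pi\<^sup>2 * (\<bar>v\<bar> / p + \<bar>u\<bar> / p)"
      by (simp add: add_divide_distrib[symmetric] add.commute)
    also have "\<bar>v\<bar> / p = h (2 * int i + 1) (2 * int j + 1)"
      by (simp add: v_def h_def p_def)
    also have "\<bar>u\<bar> / p = h (2 * int i + 1) (- (2 * int j + 1))"
    proof -
      have "(2 * int i + 1) * x + - (2 * int j + 1) * y = (2 * int i + 1) * x - (2 * int j + 1) * y"
        by (simp add: algebra_simps)
      moreover have "\<bar>real_of_int (- (2 * int j + 1))\<bar> = 2 * real j + 1" by simp
      ultimately show ?thesis unfolding u_def h_def p_def by simp
    qed
    finally show ?thesis unfolding u_def v_def .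
  qed
  have "\<bar>corr m n x y\<bar> \<le> (\<Sum>i\<le>m. \<Sum>j\<le>m. 8 / pi\<^sup>2 * (h (2 * int i + 1) (2 * int j + 1) + h (2 * int i + 1) (- (2 * int j + 1))))"
    unfolding corr_eq
    by (rule order_trans[OF sum_abs], rule sum_mono, rule order_trans[OF sum_abs], rule sum_mono, rule entry)
  also have "\<dots> = 8 / pi\<^sup>2 * (\<Sum>k\<in>odds m. \<Sum>l\<in>odds m. h k l + h k (- l))"
    by (simp only: sum_odds sum_distrib_left)
  also have "(\<Sum>k\<in>odds m. \<Sum>l\<in>odds m. h k l + h k (- l)) = (\<Sum>k\<in>odds m. \<Sum>l\<in>odds m \<union> uminus ` odds m. h k l)"
  proof (rule sum.cong[OF refl])
    fix k
    have "odds m \<inter> uminus ` odds m = {}" by (auto simp: odds_iff)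
    then have "(\<Sum>l\<in>odds m \<union> uminus ` odds m. h k l) = (\<Sum>l\<in>odds m. h k l) + (\<Sum>l\<in>uminus ` odds m. h k l)"
      by (intro sum.union_disjoint) auto
    also have "(\<Sum>l\<in>uminus ` odds m. h k l) = (\<Sum>l\<in>odds m. h k (- l))"
      by (subst sum.reindex) auto
    finally show "(\<Sum>l\<in>odds m. h k l + h k (- l)) = (\<Sum>l\<in>odds m \<union> uminus ` odds m. h k l)"
      by (simp add: sum.distrib)
  qed
  also have "\<dots> = (\<Sum>(k, l)\<in>odds m \<times> (odds m \<union> uminus ` odds m). h k l)"
    by (simp add: sum.cartesian_product)
  finally show ?thesis by (simp add: h_def)
qed

lemma odd_multiples_sum_le:
  assumes "n > 0"
  shows "(\<Sum>t\<le>m. \<bar>unit_mean n ((2 * int t + 1) * z)\<bar> / (2 * real t + 1)\<^sup>2) \<le> pi\<^sup>2 / 8"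
proof -
  have "(\<Sum>t\<le>m. \<bar>unit_mean n ((2 * int t + 1) * z)\<bar> / (2 * real t + 1)\<^sup>2) \<le> (\<Sum>t\<le>m. 1 / (2 * real t + 1)\<^sup>2)"
    by (intro sum_mono divide_right_mono abs_unit_mean_le_1 assms) auto
  also have "\<dots> \<le> pi\<^sup>2 / 8"
    using odd_inverse_squares_le[of "Suc m"] by (simp add: lessThan_Suc_atMost)
  finally show ?thesis .
qed

text \<open>As n is coprime to 3, both z and 3z are nonzero modulo n, so the terms t = 0, 1 lose
  three quarters of their weight: 3/4 (1 + 1/9) = 5/6. After scaling by 8 / pi^2 this is the saving
  20 / (3 pi^2).\<close>

lemma odd_multiples_sum_le_nonzero:
  assumes "gcd n 6 = 1" "m \<ge> 1" "\<not> int n dvd z"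
  shows "(\<Sum>t\<le>m. \<bar>unit_mean n ((2 * int t + 1) * z)\<bar> / (2 * real t + 1)\<^sup>2) \<le> pi\<^sup>2 / 8 - 5 / 6"
proof -
  have n: "n > 0" using assms(1) by (intro Nat.gr0I) auto
  have "coprime n 6" using assms(1) by (simp only: coprime_iff_gcd_eq_1)
  then have "coprime n 3" by (rule coprime_divisors[rotated 2]) simp_all
  then have "coprime (int n) (int 3)" by (simp only: coprime_int_iff)
  then have "coprime (int n) 3" by simp
  then have three: "\<not> int n dvd 3 * z" using assms(3) by (simp add: coprime_dvd_mult_right_iff)
  have small: "\<bar>unit_mean n ((2 * int t + 1) * z)\<bar> \<le> 1 / 4" if "t \<le> 1" for t
  proof (rule abs_unit_mean_le_quarter[OF assms(1)])
    have "t = 0 \<or> t = 1" using that by auto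
    then show "\<not> int n dvd (2 * int t + 1) * z" using assms(3) three by auto
  qed
  have "(\<Sum>t\<le>m. \<bar>unit_mean n ((2 * int t + 1) * z)\<bar> / (2 * real t + 1)\<^sup>2) \<le>
     (\<Sum>t\<le>m. 1 / (2 * real t + 1)\<^sup>2 - (if t \<le> 1 then 3 / 4 / (2 * real t + 1)\<^sup>2 else 0))"
  proof (intro sum_mono)
    fix t
    show "\<bar>unit_mean n ((2 * int t + 1) * z)\<bar> / (2 * real t + 1)\<^sup>2 \<le>
      1 / (2 * real t + 1)\<^sup>2 - (if t \<le> 1 then 3 / 4 / (2 * real t + 1)\<^sup>2 else 0)"
    proof (cases "t \<le> 1")
      case True
      have "\<bar>unit_mean n ((2 * int t + 1) * z)\<bar> / (2 * real t + 1)\<^sup>2 \<le> (1 - 3 / 4) / (2 * real t + 1)\<^sup>2"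
        using small[OF True] by (intro divide_right_mono) auto
      then show ?thesis using True by (simp add: diff_divide_distrib)
    next
      case False
      then show ?thesis using abs_unit_mean_le_1[OF n] by (simp add: divide_right_mono)
    qed
  qed
  also have "\<dots> = (\<Sum>t\<le>m. 1 / (2 * real t + 1)\<^sup>2) - (\<Sum>t\<le>m. if t \<le> 1 then 3 / 4 / (2 * real t + 1)\<^sup>2 else 0)"
    by (rule sum_subtractf)
  also have "(\<Sum>t\<le>m. if t \<le> 1 then 3 / 4 / (2 * real t + 1)\<^sup>2 else 0) = (\<Sum>t\<le>1. 3 / 4 / (2 * real t + 1)\<^sup>2)"
    using assms(2) by (intro sum.mono_neutral_cong_right) auto
  also have "\<dots> = 5 / 6" by simp
  also have "(\<Sum>t\<le>m. 1 / (2 * real t + 1)\<^sup>2) \<le> pi\<^sup>2 / 8"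
    using odd_inverse_squares_le[of "Suc m"] by (simp add: lessThan_Suc_atMost)
  finally show ?thesis by simp
qed

text \<open>Multiplying by the two orders and eliminating y shows that n divides r r' (k l' - k' l)
  x. Since x is a unit and r r' |k l' - k' l| is at most 2 M^2 (2m + 1)^2 < n, the determinant
  vanishes.\<close>

lemma low_order_frequencies_parallel:
  assumes "n > 0" "coprime x (int n)" "2 * M\<^sup>2 * (2 * m + 1)\<^sup>2 < n"
    and "\<bar>k\<bar> \<le> 2 * int m + 1" "\<bar>l\<bar> \<le> 2 * int m + 1" "add_order n (k * x + l * y) \<le> M"
    and "\<bar>k'\<bar> \<le> 2 * int m + 1" "\<bar>l'\<bar> \<le> 2 * int m + 1" "add_order n (k' * x + l' * y) \<le> M"
  shows "k * l' = k' * l"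
proof (rule ccontr)
  assume neq: "k * l' \<noteq> k' * l"
  define r r' where "r = int (add_order n (k * x + l * y))" and "r' = int (add_order n (k' * x + l' * y))"
  have r: "0 < r" "r \<le> int M" "0 < r'" "r' \<le> int M"
    using add_order_pos[OF assms(1)] assms(6,9) by (auto simp: r_def r'_def)
  have "int n dvd r' * l' * (r * (k * x + l * y)) - r * l * (r' * (k' * x + l' * y))"
    unfolding r_def r'_def by (intro dvd_diff dvd_mult dvd_add_order_mult)
  also have "r' * l' * (r * (k * x + l * y)) - r * l * (r' * (k' * x + l' * y)) = (r * r' * (k * l' - k' * l)) * x"
    by (simp add: algebra_simps)
  finally have "int n dvd r * r' * (k * l' - k' * l)"
    using assms(2) by (simp add: coprime_dvd_mult_left_iff coprime_commute)
  then have "int n \<le> \<bar>r * r' * (k * l' - k' * l)\<bar>"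
    using r neq by (intro zdvd_imp_le) auto
  also have "\<dots> \<le> int M * int M * ((2 * int m + 1) * (2 * int m + 1) + (2 * int m + 1) * (2 * int m + 1))"
  proof -
    have "\<bar>k * l' - k' * l\<bar> \<le> \<bar>k\<bar> * \<bar>l'\<bar> + \<bar>k'\<bar> * \<bar>l\<bar>"
      by (metis abs_mult abs_triangle_ineq4)
    also have "\<dots> \<le> (2 * int m + 1) * (2 * int m + 1) + (2 * int m + 1) * (2 * int m + 1)"
      using assms by (intro add_mono mult_mono) auto
    finally show ?thesis
      unfolding abs_mult using r by (intro mult_mono) auto
  qed
  also have "\<dots> = int (2 * M\<^sup>2 * (2 * m + 1)\<^sup>2)" by (simp add: power2_eq_square algebra_simps)
  finally show False using assms(3) by linarith
qed

text \<open>
  In the first alternative no frequency of additive order at most \<open>M\<close> occurs; in the second one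
  \<open>(k, l)\<close> spans the line that contains all of them.
\<close>

lemma abs_corr_le_line:
  fixes m n M :: nat and x y :: int
  assumes "odd n" "coprime x (int n)" "M > 0" "2 * M\<^sup>2 * (2 * m + 1)\<^sup>2 < n"
  obtains "\<bar>corr m n x y\<bar> \<le> 2 * (real m + 1)\<^sup>2 / sqrt M"
  | k l where "odd k" "odd l" "0 < k"
      "\<bar>corr m n x y\<bar> \<le> 8 / pi\<^sup>2 *
        ((\<Sum>t\<le>m. \<bar>unit_mean n ((2 * int t + 1) * (k * x + l * y))\<bar> / (2 * real t + 1)\<^sup>2) / (of_int k * \<bar>of_int l\<bar>))
        + 2 * (real m + 1)\<^sup>2 / sqrt M"
proof -
  have n: "n > 0" using assms(1) by (rule odd_pos)
  define I where "I = odds m \<times> (odds m \<union> uminus ` odds m)"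
  define w :: "int \<times> int \<Rightarrow> real" where "w = (\<lambda>(k, l). \<bar>unit_mean n (k * x + l * y)\<bar> / (real_of_int k * \<bar>real_of_int l\<bar>))"
  define B where "B = {(k, l) \<in> I. add_order n (k * x + l * y) \<le> M}"
  have finI: "finite I" by (simp add: I_def)
  have I: "odd k" "odd l" "0 < k" "k \<le> 2 * int m + 1" "\<bar>l\<bar> \<le> 2 * int m + 1" "l \<noteq> 0"
    if "(k, l) \<in> I" for k l
    using that by (auto simp: I_def odds_iff)
  have "w p \<le> 1 / sqrt M" if p: "p \<in> I - B" for p
  proof -
    obtain k l where kl: "p = (k, l)" by (cases p)
    then have kl': "(k, l) \<in> I" "M \<le> add_order n (k * x + l * y)" using p by (auto simp: B_def)
    have "1 \<le> real_of_int k" "1 \<le> \<bar>real_of_int l\<bar>" using I[OF kl'(1)] by linarith+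
    then have "1 * 1 \<le> real_of_int k * \<bar>real_of_int l\<bar>" by (intro mult_mono) auto
    then have "w p \<le> \<bar>unit_mean n (k * x + l * y)\<bar> / 1"
      unfolding kl w_def prod.case by (intro divide_left_mono) auto
    also have "\<dots> \<le> 1 / sqrt M" using abs_unit_mean_le_sqrt[OF assms(1,3) kl'(2)] by simp
    finally show ?thesis .
  qed
  then have "(\<Sum>p\<in>I - B. w p) \<le> real (card (I - B)) * (1 / sqrt M)"
    by (rule sum_bounded_above)
  also have "\<dots> \<le> (2 * (real m + 1)\<^sup>2) * (1 / sqrt M)"
  proof (intro mult_right_mono)
    have "card (odds m \<union> uminus ` odds m) \<le> 2 * (m + 1)"
      using card_Un_le[of "odds m" "uminus ` odds m"] card_image_le[of "odds m" uminus] by simp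
    then have "card I \<le> (m + 1) * (2 * (m + 1))"
      unfolding I_def card_cartesian_product by (simp only: card_odds mult_le_mono2)
    then have "card (I - B) \<le> (m + 1) * (2 * (m + 1))"
      using card_mono[OF finI Diff_subset[of I B]] by linarith
    then have "real (card (I - B)) \<le> real ((m + 1) * (2 * (m + 1)))" by (simp only: of_nat_le_iff)
    also have "\<dots> = 2 * (real m + 1)\<^sup>2" by (simp add: power2_eq_square algebra_simps)
    finally show "real (card (I - B)) \<le> 2 * (real m + 1)\<^sup>2" .
  qed auto
  finally have high: "(\<Sum>p\<in>I - B. w p) \<le> 2 * (real m + 1)\<^sup>2 / sqrt M" by simp
  have pi: "8 / pi\<^sup>2 \<le> 1"
    using odd_inverse_squares_le[of 1] by simp
  have "\<bar>corr m n x y\<bar> \<le> 8 / pi\<^sup>2 * (\<Sum>p\<in>I. w p)"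
    using abs_corr_le_frequencies[of m n x y] by (simp add: w_def I_def)
  also have "(\<Sum>p\<in>I. w p) = (\<Sum>p\<in>B. w p) + (\<Sum>p\<in>I - B. w p)"
    using sum.subset_diff[of B I w] finI by (auto simp: B_def add.commute)
  also have "8 / pi\<^sup>2 * \<dots> = 8 / pi\<^sup>2 * (\<Sum>p\<in>B. w p) + 8 / pi\<^sup>2 * (\<Sum>p\<in>I - B. w p)"
    by (rule distrib_left)
  also have "8 / pi\<^sup>2 * (\<Sum>p\<in>I - B. w p) \<le> 1 * (2 * (real m + 1)\<^sup>2 / sqrt M)"
    using high pi by (intro mult_mono sum_nonneg) (auto simp: w_def I_def odds_iff)
  finally have split: "\<bar>corr m n x y\<bar> \<le> 8 / pi\<^sup>2 * (\<Sum>p\<in>B. w p) + 2 * (real m + 1)\<^sup>2 / sqrt M"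
    by simp
  show thesis
  proof (cases "B = {}")
    case True
    then show thesis using split that(1) by simp
  next
    case False
    then obtain k1 l1 where b: "(k1, l1) \<in> B" by auto
    then have b1: "(k1, l1) \<in> I" "add_order n (k1 * x + l1 * y) \<le> M" by (auto simp: B_def)
    \<comment> \<open>Dividing by the gcd gives a primitive pair; every other pair of low order is
      parallel to it, hence an integer multiple, and an odd one by parity.\<close>
    define d where "d = gcd k1 l1"
    define k l where "k = k1 div d" and "l = l1 div d"
    have "d > 0" using I(3)[OF b1(1)] by (simp add: d_def gcd_pos_int)
    have kl: "k1 = k * d" "l1 = l * d" by (simp_all add: k_def l_def d_def)
    have cop: "coprime k l" using I(3)[OF b1(1)] unfolding k_def l_def d_def by (intro div_gcd_coprime) auto
    have k: "odd k" "odd l" "0 < k" using I[OF b1(1)] \<open>d > 0\<close> unfolding kl by (auto simp: zero_less_mult_iff)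
    \<comment> \<open>The multiples (2t + 1)(k, l) with t \<le> m cover \<open>B\<close> but may
      leave it; the surplus terms are nonnegative.\<close>
    have "(\<Sum>p\<in>B. w p) \<le> (\<Sum>t\<le>m. \<bar>unit_mean n ((2 * int t + 1) * (k * x + l * y))\<bar> / (2 * real t + 1)\<^sup>2 / (of_int k * \<bar>of_int l\<bar>))"
    proof (rule sum_le_included[where i = "\<lambda>t. ((2 * int t + 1) * k, (2 * int t + 1) * l)"])
      show "finite B" using finI by (rule finite_subset[rotated]) (auto simp: B_def)
      show "\<forall>t\<in>{..m}. 0 \<le> \<bar>unit_mean n ((2 * int t + 1) * (k * x + l * y))\<bar> / (2 * real t + 1)\<^sup>2 / (of_int k * \<bar>of_int l\<bar>)"
        using k by auto
      show "\<forall>p\<in>B. \<exists>t\<in>{..m}. ((2 * int t + 1) * k, (2 * int t + 1) * l) = p \<and>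
          w p \<le> \<bar>unit_mean n ((2 * int t + 1) * (k * x + l * y))\<bar> / (2 * real t + 1)\<^sup>2 / (of_int k * \<bar>of_int l\<bar>)"
      proof
        fix p assume "p \<in> B"
        then obtain k' l' where p: "p = (k', l')" "(k', l') \<in> I" "add_order n (k' * x + l' * y) \<le> M"
          by (auto simp: B_def)
        have "k1 * l' = k' * l1"
          by (rule low_order_frequencies_parallel[OF n assms(2,4)])
             (use I[OF b1(1)] I[OF p(2)] b1(2) p(3) in auto)
        then have par: "k * l' = k' * l" using \<open>d > 0\<close> by (simp add: kl mult_ac)
        then have "k dvd k'" using cop by (metis coprime_dvd_mult_left_iff dvd_triv_left)
        then obtain j where j: "k' = j * k" by (metis dvdE mult.commute)
        then have l': "l' = j * l" using par k by simp
        have "odd j" "0 < j" "j \<le> 2 * int m + 1"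
        proof -
          show "odd j" "0 < j" using I[OF p(2)] k(3) unfolding j by (auto simp: zero_less_mult_iff)
          then have "j * 1 \<le> j * k" using k(3) by (intro mult_left_mono) auto
          then show "j \<le> 2 * int m + 1" using I(4)[OF p(2)] j by simp
        qed
        then obtain t where t: "t \<le> m" "j = 2 * int t + 1" using odds_iff[of j m] by (auto simp: odds_def)
        have "w p = \<bar>unit_mean n (j * (k * x + l * y))\<bar> / (of_int j)\<^sup>2 / (of_int k * \<bar>of_int l\<bar>)"
        proof -
          have "j * k * x + j * l * y = j * (k * x + l * y)" by (simp add: algebra_simps)
          moreover have "real_of_int (j * k) * \<bar>real_of_int (j * l)\<bar> = (of_int j)\<^sup>2 * (of_int k * \<bar>of_int l\<bar>)"
            using \<open>0 < j\<close> by (simp add: abs_mult power2_eq_square)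
          ultimately show ?thesis by (simp add: w_def p(1) j l')
        qed
        then show "\<exists>t\<in>{..m}. ((2 * int t + 1) * k, (2 * int t + 1) * l) = p \<and>
          w p \<le> \<bar>unit_mean n ((2 * int t + 1) * (k * x + l * y))\<bar> / (2 * real t + 1)\<^sup>2 / (of_int k * \<bar>of_int l\<bar>)"
          using t p(1) j l' by (intro bexI[of _ t]) auto
      qed
    qed auto
    then have "8 / pi\<^sup>2 * (\<Sum>p\<in>B. w p) \<le> 8 / pi\<^sup>2 *
        ((\<Sum>t\<le>m. \<bar>unit_mean n ((2 * int t + 1) * (k * x + l * y))\<bar> / (2 * real t + 1)\<^sup>2) / (of_int k * \<bar>of_int l\<bar>))"
      by (intro mult_left_mono) (auto simp: sum_divide_distrib)
    then show thesis using split by (intro that(2)[OF k]) linarith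
  qed
qed

text \<open>Case distinction on the odd number q = k |l|. For q = 1 the frequency is x + y or x - y,
  nonzero by assumption, so the saving applies. For q = 3 it is one of the four relations: the
  trivial bound is 1/3, with the saving if the relation fails. For q \<ge> 5 the trivial bound 1/5
  is enough.\<close>

lemma abs_corr_le:
  fixes m n M :: nat and x y :: int
  assumes n: "gcd n 6 = 1" and x: "coprime x (int n)" and m: "m \<ge> 1" and M: "M > 0" "2 * M\<^sup>2 * (2 * m + 1)\<^sup>2 < n"
    and pm: "\<not> int n dvd x + y" "\<not> int n dvd x - y"
  shows "\<bar>corr m n x y\<bar> \<le> 1 / 3 + 2 * (real m + 1)\<^sup>2 / sqrt M"
    and "\<lbrakk>\<not> int n dvd x + 3 * y; \<not> int n dvd x - 3 * y; \<not> int n dvd 3 * x + y; \<not> int n dvd 3 * x - y\<rbrakk>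
      \<Longrightarrow> \<bar>corr m n x y\<bar> \<le> 1 - 20 / (3 * pi\<^sup>2) + 2 * (real m + 1)\<^sup>2 / sqrt M"
proof -
  have odd: "odd n" using gcd_greatest[of 2 n 6] n by auto
  have pi2: "pi\<^sup>2 < 10" "pi\<^sup>2 > 0" by (auto simp: pi_square_less_10)
  \<comment> \<open>Two terms give pi^2 \<ge> 80/9, above the value 25/3 at which 1 - 20 / (3 pi^2)
    equals 1/5.\<close>
  have "pi\<^sup>2 / 8 \<ge> 1 + 1 / 9" using odd_inverse_squares_le[of 2] by (simp add: numeral_2_eq_2)
  then have c5: "1 / 5 \<le> 1 - 20 / (3 * pi\<^sup>2)" using pi2 by (simp add: field_simps)
  have c3: "1 - 20 / (3 * pi\<^sup>2) \<le> 1 / 3" using pi2 by (simp add: field_simps)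
  define \<eta> where "\<eta> = 2 * (real m + 1)\<^sup>2 / sqrt M"
  have claim: "\<bar>corr m n x y\<bar> \<le> 1 - 20 / (3 * pi\<^sup>2) + \<eta> \<or>
    \<bar>corr m n x y\<bar> \<le> 1 / 3 + \<eta> \<and>
     (int n dvd x + 3 * y \<or> int n dvd x - 3 * y \<or> int n dvd 3 * x + y \<or> int n dvd 3 * x - y)"
  proof (rule abs_corr_le_line[OF odd x M, of y])
    assume "\<bar>corr m n x y\<bar> \<le> 2 * (real m + 1)\<^sup>2 / sqrt M"
    then show ?thesis using c5 by (simp add: \<eta>_def)
  next
    fix k l :: int
    assume kl: "odd k" "odd l" "0 < k"
    define z where "z = k * x + l * y"
    define S where "S = (\<Sum>t\<le>m. \<bar>unit_mean n ((2 * int t + 1) * z)\<bar> / (2 * real t + 1)\<^sup>2)"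
    define q where "q = k * \<bar>l\<bar>"
    assume "\<bar>corr m n x y\<bar> \<le> 8 / pi\<^sup>2 *
        ((\<Sum>t\<le>m. \<bar>unit_mean n ((2 * int t + 1) * (k * x + l * y))\<bar> / (2 * real t + 1)\<^sup>2) / (of_int k * \<bar>of_int l\<bar>))
        + 2 * (real m + 1)\<^sup>2 / sqrt M"
    then have le: "\<bar>corr m n x y\<bar> \<le> 8 / pi\<^sup>2 * (S / of_int q) + \<eta>"
      by (simp add: S_def z_def q_def \<eta>_def)
    have S: "S \<le> pi\<^sup>2 / 8" unfolding S_def using odd_multiples_sum_le odd odd_pos by blast
    have S': "S \<le> pi\<^sup>2 / 8 - 5 / 6" if "\<not> int n dvd z"
      unfolding S_def by (rule odd_multiples_sum_le_nonzero[OF n m that])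
    have S0: "S \<ge> 0" unfolding S_def by (intro sum_nonneg) auto
    have "l \<noteq> 0" using kl(2) by auto
    then have q: "odd q" "q > 0" using kl by (auto simp: q_def)
    have div: "\<bar>corr m n x y\<bar> \<le> 8 / pi\<^sup>2 * (T / r) + \<eta>" if "S \<le> T" "r \<le> real_of_int q" "0 < r" for T r
    proof -
      have "S / of_int q \<le> T / r" using that S0 by (intro frac_le) auto
      then have "8 / pi\<^sup>2 * (S / of_int q) \<le> 8 / pi\<^sup>2 * (T / r)" by (intro mult_left_mono) auto
      then show ?thesis using le by linarith
    qed
    have nonzero: "\<bar>corr m n x y\<bar> \<le> 1 - 20 / (3 * pi\<^sup>2) + \<eta>" if "\<not> int n dvd z"
    proof -
      have "8 / pi\<^sup>2 * ((pi\<^sup>2 / 8 - 5 / 6) / 1) = 1 - 20 / (3 * pi\<^sup>2)" by (simp add: field_simps)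
      then show ?thesis using div[OF S'[OF that], of 1] q by simp
    qed
    have "q = 1 \<or> q = 3 \<or> q \<ge> 5" using q by presburger
    then show ?thesis
    proof (elim disjE)
      assume "q = 1"
      then have "k = 1" "\<bar>l\<bar> = 1" using kl(3) by (auto simp: q_def zmult_eq_1_iff)
      then have "k = 1" "l = 1 \<or> l = - 1" by linarith+
      then have "z = x + y \<or> z = x - y" by (auto simp: z_def)
      then show ?thesis using nonzero pm by auto
    next
      assume q3: "q = 3"
      have "k = 1 \<and> (l = 3 \<or> l = - 3) \<or> k = 3 \<and> (l = 1 \<or> l = - 1)"
      proof -
        have "k dvd 3" using q3 q_def by (metis dvd_triv_left)
        then have "k \<le> 3" by (rule zdvd_imp_le) simp
        then have "k = 1 \<or> k = 3" using kl by presburger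
        then have "k = 1 \<and> \<bar>l\<bar> = 3 \<or> k = 3 \<and> \<bar>l\<bar> = 1" using q3 q_def by auto
        then show ?thesis by linarith
      qed
      then have z: "z = x + 3 * y \<or> z = x - 3 * y \<or> z = 3 * x + y \<or> z = 3 * x - y"
        by (auto simp: z_def)
      have "\<bar>corr m n x y\<bar> \<le> 1 / 3 + \<eta>" using div[OF S, of 3] q3 by simp
      then show ?thesis using nonzero z by auto
    next
      assume "q \<ge> 5"
      then have "\<bar>corr m n x y\<bar> \<le> 1 / 5 + \<eta>" using div[OF S, of 5] by simp
      then show ?thesis using c5 by linarith
    qed
  qed
  then show "\<bar>corr m n x y\<bar> \<le> 1 / 3 + 2 * (real m + 1)\<^sup>2 / sqrt M"
    using c3 by (auto simp: \<eta>_def)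
  show "\<bar>corr m n x y\<bar> \<le> 1 - 20 / (3 * pi\<^sup>2) + 2 * (real m + 1)\<^sup>2 / sqrt M"
    if "\<not> int n dvd x + 3 * y" "\<not> int n dvd x - 3 * y" "\<not> int n dvd 3 * x + y" "\<not> int n dvd 3 * x - y"
    using claim that by (auto simp: \<eta>_def)
qed

section \<open>Counting units in the half interval\<close>

definition half_sgn :: "nat \<Rightarrow> int \<Rightarrow> real" where
  "half_sgn n z = sgn (sin (2 * pi * of_int z / n))"

text \<open>The sine vanishes only at residues 0 and n / 2; the first is excluded by the
  divisibility assumption, the second because n is odd.\<close>

lemma half_sgn_eq:
  assumes "odd n" "\<not> int n dvd z"
  shows "half_sgn n z = (if real_of_int (z mod int n) / real n \<in> {0..1/2} then 1 else - 1)"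
proof -
  define h where "h = z mod int n"
  have n: "n > 0" using assms(1) by (rule odd_pos)
  have "h \<noteq> 0" using assms(2) by (simp add: h_def dvd_eq_mod_eq_0)
  moreover have "0 \<le> h" "h < int n" using n by (simp_all add: h_def)
  ultimately have h: "0 < h" "h < int n" by linarith+
  have "z = h + int n * (z div int n)" by (simp add: h_def)
  then have "real_of_int z = of_int h + of_nat n * of_int (z div int n)"
    by (metis of_int_add of_int_mult of_int_of_nat_eq)
  then have "2 * pi * of_int z / n = 2 * pi * of_int h / n + 2 * pi * of_int (z div int n)"
    using n by (simp add: field_simps)
  then have sin: "sin (2 * pi * of_int z / n) = sin (2 * pi * of_int h / n)"
    by (simp add: sin_add sin_int_2pin cos_int_2pin)
  have "2 * h \<noteq> int n" using assms(1) by presburger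
  then consider "2 * h < int n" | "int n < 2 * h" by linarith
  then show ?thesis
  proof cases
    case 1
    then have lt: "2 * real_of_int h < n" by linarith
    then have "2 * of_int h / n < (1::real)" using n by (simp add: divide_less_eq)
    from mult_strict_left_mono[OF this pi_gt_zero] have "2 * pi * of_int h / n < pi" by (simp add: mult_ac)
    moreover have "0 < 2 * pi * of_int h / n" using h n by simp
    ultimately have "sin (2 * pi * of_int h / n) > 0" by (intro sin_gt_zero)
    moreover have "real_of_int h / n \<in> {0..1/2}" using h lt n by (simp add: divide_le_eq)
    ultimately show ?thesis by (simp add: half_sgn_def sin h_def[symmetric])
  next
    case 2
    then have lt: "n < 2 * real_of_int h" by linarith
    then have "1 < 2 * of_int h / real n" using n by (simp add: less_divide_eq)
    from mult_strict_left_mono[OF this pi_gt_zero] have "pi < 2 * pi * of_int h / n" by (simp add: mult_ac)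
    moreover have "2 * pi * of_int h / n < 2 * pi"
    proof -
      have "of_int h / real n < 1" using h n by (simp add: divide_less_eq)
      from mult_strict_left_mono[OF this, of "2 * pi"] show ?thesis by simp
    qed
    ultimately have "sin (2 * pi * of_int h / n) < 0" by (intro sin_lt_zero)
    moreover have "real_of_int h / n \<notin> {0..1/2}" using lt n by (simp add: divide_le_eq)
    ultimately show ?thesis by (simp add: half_sgn_def sin h_def[symmetric])
  qed
qed

lemma half_sgn_reflect:
  assumes "n > 0"
  shows "half_sgn n (x * (int n - g)) = - half_sgn n (x * g)"
proof -
  have "2 * pi * of_int (x * (int n - g)) / n = 2 * pi * of_int x - 2 * pi * of_int (x * g) / n"
    using assms by (simp add: field_simps)
  then have "sin (2 * pi * of_int (x * (int n - g)) / n) = - sin (2 * pi * of_int (x * g) / n)"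
    by (simp add: sin_diff sin_int_2pin cos_int_2pin del: of_int_mult of_int_diff)
  then show ?thesis by (simp add: half_sgn_def sgn_minus)
qed

lemma sum_totatives_reflect:
  assumes "n > 1"
  shows "(\<Sum>g\<in>totatives n. f (int g)) = (\<Sum>g\<in>totatives n. f (int n - int g))"
proof (rule sum.reindex_bij_witness[of _ "\<lambda>g. n - g" "\<lambda>g. n - g"])
  fix g assume g: "g \<in> totatives n"
  then have lt: "g < n" using totatives_less assms by blast
  then show "n - (n - g) = g" by simp
  show "f (int n - int (n - g)) = f (int g)" using lt by simp
  have "coprime (n - g) n"
    using g lt by (simp only: in_totatives_iff coprime_iff_gcd_eq_1 gcd_diff2_nat less_imp_le)
  then show "n - g \<in> totatives n" using lt by (simp add: in_totatives_iff)
next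
  fix g assume g: "g \<in> totatives n"
  then have lt: "g < n" using totatives_less assms by blast
  then show "n - (n - g) = g" by simp
  have "coprime (n - g) n"
    using g lt by (simp only: in_totatives_iff coprime_iff_gcd_eq_1 gcd_diff2_nat less_imp_le)
  then show "n - g \<in> totatives n" using lt by (simp add: in_totatives_iff)
qed

text \<open>Pointwise, pq - st = p (q - t) + (p - s) t with |p|, |t| \<le> 1, so replacing signs by
  polynomials costs at most (1 - p^2) + (1 - q^2). Summing turns these into deficits of
  self-correlations.\<close>

lemma sum_half_sgn_ge:
  assumes "n > 0"
  shows "(\<Sum>g\<in>totatives n. half_sgn n (x * int g) * half_sgn n (y * int g)) \<ge>
     totient n * (corr m n x y - (1 - corr m n x x) - (1 - corr m n y y))"
proof -
  have pointwise: "wave m n u * wave m n v - (1 - wave m n u * wave m n u) - (1 - wave m n v * wave m n v)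
      \<le> half_sgn n u * half_sgn n v" for u v
  proof -
    define s t p q where "s = half_sgn n u" and "t = half_sgn n v" and "p = wave m n u" and "q = wave m n v"
    have e: "\<bar>s - p\<bar> \<le> 1 - p\<^sup>2" "\<bar>p\<bar> \<le> 1" "\<bar>t - q\<bar> \<le> 1 - q\<^sup>2"
      unfolding s_def t_def p_def q_def half_sgn_def wave_def by (intro sgn_approx_error; simp)+
    have t: "\<bar>t\<bar> \<le> 1" by (simp add: t_def half_sgn_def sgn_if)
    have "\<bar>p * q - s * t\<bar> = \<bar>p * (q - t) + (p - s) * t\<bar>" by (simp add: algebra_simps)
    also have "\<dots> \<le> \<bar>p\<bar> * \<bar>q - t\<bar> + \<bar>p - s\<bar> * \<bar>t\<bar>"
      unfolding abs_mult[symmetric] by (rule abs_triangle_ineq)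
    also have "\<dots> \<le> 1 * \<bar>q - t\<bar> + \<bar>p - s\<bar> * 1"
      using e t by (intro add_mono mult_mono) auto
    finally have "p * q - s * t \<le> (1 - p\<^sup>2) + (1 - q\<^sup>2)"
      using e abs_minus_commute[of q t] abs_minus_commute[of p s] abs_ge_self[of "p * q - s * t"] by linarith
    then show ?thesis by (simp add: s_def t_def p_def q_def power2_eq_square)
  qed
  have "totient n * (corr m n x y - (1 - corr m n x x) - (1 - corr m n y y)) =
    (\<Sum>g\<in>totatives n. wave m n (x * int g) * wave m n (y * int g)
       - (1 - wave m n (x * int g) * wave m n (x * int g)) - (1 - wave m n (y * int g) * wave m n (y * int g)))"
  proof -
    have "T * (A / T - (1 - B / T) - (1 - C / T)) = A - (T - B) - (T - C)" if "T > 0" for T A B C :: real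
      using that by (simp add: field_simps)
    moreover have "real (totient n) > 0" using assms by simp
    ultimately show ?thesis
      by (simp only: corr_def sum_subtractf) (simp add: totient_def)
  qed
  also have "\<dots> \<le> (\<Sum>g\<in>totatives n. half_sgn n (x * int g) * half_sgn n (y * int g))"
    by (intro sum_mono pointwise)
  finally show ?thesis .
qed

text \<open>The product of the three factors 1 + s is 8 times the indicator. The factor
  \<open>1 *\<close> gives all three sums the same shape.\<close>

lemma card_half_interval_units:
  fixes n :: nat and a b :: int
  assumes "odd n" "n > 1" "coprime a (int n)" "coprime b (int n)"
  shows "8 * real (card {g \<in> Units (residue_ring (int n)).
                real_of_int (g mod int n) / real n \<in> {0..1/2} \<and>
                real_of_int ((a * g) mod int n) / real n \<in> {0..1/2} \<and>
                real_of_int ((b * g) mod int n) / real n \<in> {0..1/2}}) =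
    totient n + (\<Sum>g\<in>totatives n. half_sgn n (1 * int g) * half_sgn n (a * int g))
      + (\<Sum>g\<in>totatives n. half_sgn n (1 * int g) * half_sgn n (b * int g))
      + (\<Sum>g\<in>totatives n. half_sgn n (a * int g) * half_sgn n (b * int g))"
proof -
  define Q where "Q g \<longleftrightarrow> real_of_int (g mod int n) / real n \<in> {0..1/2} \<and>
                real_of_int ((a * g) mod int n) / real n \<in> {0..1/2} \<and>
                real_of_int ((b * g) mod int n) / real n \<in> {0..1/2}" for g
  have Units: "Units (residue_ring (int n)) = int ` totatives n"
  proof -
    interpret residues "int n" "residue_ring (int n)" by unfold_locales (use assms(2) in auto)
    have "{x. 0 < x \<and> x < int n \<and> coprime x (int n)} = int ` totatives n"
    proof (intro equalityI subsetI)
      fix z assume "z \<in> {x. 0 < x \<and> x < int n \<and> coprime x (int n)}"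
      then have "nat z \<in> totatives n" "z = int (nat z)"
        by (auto simp: in_totatives_iff simp flip: coprime_int_iff)
      then show "z \<in> int ` totatives n" by blast
    qed (use assms(2) totatives_less in \<open>auto simp: in_totatives_iff\<close>)
    then show ?thesis by (simp add: res_units_eq)
  qed
  have "{g \<in> Units (residue_ring (int n)). Q g} = int ` {g \<in> totatives n. Q (int g)}"
    by (auto simp: Units)
  then have "real (card {g \<in> Units (residue_ring (int n)). Q g}) = card {g \<in> totatives n. Q (int g)}"
    by (simp add: card_image)
  also have "\<dots> = (\<Sum>g\<in>totatives n. if Q (int g) then 1 else 0)"
    by (simp add: sum.If_cases Int_def)
  also have "8 * \<dots> = (\<Sum>g\<in>totatives n. (1 + half_sgn n (1 * int g)) * (1 + half_sgn n (a * int g)) * (1 + half_sgn n (b * int g)))"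
    unfolding sum_distrib_left
  proof (intro sum.cong refl)
    fix g assume g: "g \<in> totatives n"
    have "\<not> int n dvd c * int g" if "coprime c (int n)" for c
    proof -
      have "coprime (c * int g) (int n)" using that g by (simp add: in_totatives_iff)
      then have "is_unit (int n)" if "int n dvd c * int g"
        using that by (rule coprime_common_divisor) simp
      then show ?thesis using assms(2) by auto
    qed
    then have "half_sgn n (c * int g) = (if real_of_int ((c * int g) mod int n) / real n \<in> {0..1/2} then 1 else - 1)"
      if "coprime c (int n)" for c
      using half_sgn_eq[OF assms(1)] that by blast
    from this[of 1] this[of a] this[of b] assms(3,4)
    show "8 * (if Q (int g) then 1 else 0) = (1 + half_sgn n (1 * int g)) * (1 + half_sgn n (a * int g)) * (1 + half_sgn n (b * int g))"
      by (simp add: Q_def)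
  qed
  finally have count: "8 * real (card {g \<in> Units (residue_ring (int n)). Q g}) = \<dots>" .
  have "n > 0" using assms(2) by simp
  \<comment> \<open>Adding the sum reflected under g to -g cancels the terms with one or three signs
    and doubles the constant and the pair products.\<close>
  have "2 * (8 * real (card {g \<in> Units (residue_ring (int n)). Q g})) =
    (\<Sum>g\<in>totatives n. (1 + half_sgn n (1 * int g)) * (1 + half_sgn n (a * int g)) * (1 + half_sgn n (b * int g))) +
    (\<Sum>g\<in>totatives n. (1 - half_sgn n (1 * int g)) * (1 - half_sgn n (a * int g)) * (1 - half_sgn n (b * int g)))"
    using sum_totatives_reflect[OF assms(2), of "\<lambda>g. (1 + half_sgn n (1 * g)) * (1 + half_sgn n (a * g)) * (1 + half_sgn n (b * g))"]
    unfolding count by (simp only: half_sgn_reflect[OF \<open>n > 0\<close>] diff_conv_add_uminus[symmetric] mult_2)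
  also have "\<dots> = (\<Sum>g\<in>totatives n. 2 * (1 + half_sgn n (1 * int g) * half_sgn n (a * int g)
      + half_sgn n (1 * int g) * half_sgn n (b * int g) + half_sgn n (a * int g) * half_sgn n (b * int g)))"
    unfolding sum.distrib[symmetric] by (intro sum.cong refl) (simp only: algebra_simps)
  finally show ?thesis
    by (simp add: sum.distrib sum_distrib_left[symmetric] totient_def Q_def)
qed

section \<open>Choice of constants and conclusion\<close>

theorem theorem2:
  shows "\<exists>(c::real) (N::nat). c > 0 \<and>
    (\<forall>(n::nat) (a::int) (b::int).
       n > N \<longrightarrow> gcd n 6 = 1 \<longrightarrow> coprime a (int n) \<longrightarrow> coprime b (int n) \<longrightarrow>
       (\<forall>(x, y) \<in> {(1, a), (1, b), (a, b)}.
          \<not> [x + y = 0] (mod int n) \<and> \<not> [x - y = 0] (mod int n)) \<longrightarrow>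
       (\<exists>(x, y) \<in> {(1, a), (1, b), (a, b)}.
          \<not> [x + 3 * y = 0] (mod int n) \<and> \<not> [x - 3 * y = 0] (mod int n) \<and>
          \<not> [3 * x + y = 0] (mod int n) \<and> \<not> [3 * x - y = 0] (mod int n)) \<longrightarrow>
       real (card {g \<in> Units (residue_ring (int n)).
                real_of_int (g mod int n) / real n \<in> {0..1/2} \<and>
                real_of_int ((a * g) mod int n) / real n \<in> {0..1/2} \<and>
                real_of_int ((b * g) mod int n) / real n \<in> {0..1/2}})
         \<ge> c * real (totient n))"
proof -
  \<comment> \<open>The margin 1 - 1/3 - 1/3 - (1 - 20 / (3 pi^2)), left when one pair has the
    better bound.\<close>
  define \<delta> where "\<delta> = 20 / (3 * pi\<^sup>2) - 2 / 3"
  have "\<delta> > 0" using pi_square_less_10 by (simp add: \<delta>_def field_simps)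
  \<comment> \<open>Each of the three sign correlations loses 5 \<epsilon>: twice 2 \<epsilon> from
    the self-correlations and \<epsilon> from frequencies of high order. The total 15 \<epsilon> is
    half of \<delta>.\<close>
  define \<epsilon> where "\<epsilon> = \<delta> / 30"
  have "\<epsilon> > 0" using \<open>\<delta> > 0\<close> by (simp add: \<epsilon>_def)
  obtain m where m: "m \<ge> 1" "(\<Sum>j\<le>m. (fourier_coeff m j)\<^sup>2) / 2 > 1 - \<epsilon>"
    using exists_fourier_coeff_square_sum[OF \<open>\<epsilon> > 0\<close>] by blast
  \<comment> \<open>\<open>K / sqrt M\<close> is the error in \<open>corr_self_ge\<close> and twice
    that in \<open>abs_corr_le\<close>, so one choice of \<open>M\<close> controls both.\<close>
  define K where "K = 4 * (real m + 1)\<^sup>2"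
  have "K > 0" by (simp add: K_def add_pos_nonneg)
  obtain M :: nat where M: "(K / \<epsilon>)\<^sup>2 < M" using reals_Archimedean2 by blast
  then have "K / \<epsilon> < sqrt M" by (rule real_less_rsqrt)
  then have K: "K / sqrt M \<le> \<epsilon>"
    using \<open>K > 0\<close> \<open>\<epsilon> > 0\<close> by (simp add: divide_simps split: if_splits) (simp add: mult.commute)
  have "M > 0" using M by (metis gr0I not_less of_nat_0 zero_le_power2)
  define N where "N = 2 * M\<^sup>2 * (2 * m + 1)\<^sup>2"
  have main: "real (card {g \<in> Units (residue_ring (int n)).
                real_of_int (g mod int n) / real n \<in> {0..1/2} \<and>
                real_of_int ((a * g) mod int n) / real n \<in> {0..1/2} \<and>
                real_of_int ((b * g) mod int n) / real n \<in> {0..1/2}})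
         \<ge> \<delta> / 16 * real (totient n)"
    if n: "n > N" "gcd n 6 = 1" and ab: "coprime a (int n)" "coprime b (int n)"
      and pm: "\<forall>(x, y) \<in> {(1, a), (1, b), (a, b)}. \<not> [x + y = 0] (mod int n) \<and> \<not> [x - y = 0] (mod int n)"
      and good: "\<exists>(x, y) \<in> {(1, a), (1, b), (a, b)}.
          \<not> [x + 3 * y = 0] (mod int n) \<and> \<not> [x - 3 * y = 0] (mod int n) \<and>
          \<not> [3 * x + y = 0] (mod int n) \<and> \<not> [3 * x - y = 0] (mod int n)"
    for n :: nat and a b :: int
  proof -
    define T where "T = real (totient n)"
    define s where "s x y = (\<Sum>g\<in>totatives n. half_sgn n (x * int g) * half_sgn n (y * int g))" for x y
    have odd: "odd n" using gcd_greatest[of 2 n 6] n(2) by auto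
    have "N \<ge> 1" using \<open>M > 0\<close> by (simp add: N_def)
    then have n1: "n > 1" using n(1) by linarith
    have "2 * M * (2 * m + 1) \<le> N"
      unfolding N_def power2_eq_square using \<open>M > 0\<close> by (intro mult_le_mono) auto
    then have big: "n > 2 * M * (2 * m + 1)" using n(1) by linarith
    have self: "1 - corr m n x x \<le> 2 * \<epsilon>" if "coprime x (int n)" for x
      using corr_self_ge[OF odd that \<open>M > 0\<close> big] m(2) K by (simp add: K_def)
    have "2 * (real m + 1)\<^sup>2 / sqrt M \<le> K / sqrt M"
      by (intro divide_right_mono) (auto simp: K_def)
    then have eta: "2 * (real m + 1)\<^sup>2 / sqrt M \<le> \<epsilon>" using K by linarith
    have s: "s x y \<ge> T * (c - 4 * \<epsilon>)"
      if "coprime x (int n)" "coprime y (int n)" "c \<le> corr m n x y" for x y c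
    proof -
      have "T * (c - 4 * \<epsilon>) \<le> T * (corr m n x y - (1 - corr m n x x) - (1 - corr m n y y))"
        using self[OF that(1)] self[OF that(2)] that(3) by (intro mult_left_mono) (auto simp: T_def)
      also have "\<dots> \<le> s x y" unfolding T_def s_def using n1 by (intro sum_half_sgn_ge) simp
      finally show ?thesis .
    qed
    have pair: "s x y \<ge> T * (- (1 / 3) - 5 * \<epsilon>)"
        "\<lbrakk>\<not> int n dvd x + 3 * y; \<not> int n dvd x - 3 * y; \<not> int n dvd 3 * x + y; \<not> int n dvd 3 * x - y\<rbrakk>
          \<Longrightarrow> s x y \<ge> T * (- (1 - 20 / (3 * pi\<^sup>2)) - 5 * \<epsilon>)"
      if "(x, y) \<in> {(1, a), (1, b), (a, b)}" for x y
    proof -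
      have cop: "coprime x (int n)" "coprime y (int n)" using that ab by auto
      have "\<not> int n dvd x + y" "\<not> int n dvd x - y" using pm that by (auto simp: cong_0_iff)
      note le = abs_corr_le[OF n(2) cop(1) m(1) \<open>M > 0\<close> n(1)[unfolded N_def] this]
      have "- (1 / 3) - \<epsilon> \<le> corr m n x y" using le(1) eta by linarith
      from s[OF cop this] show "s x y \<ge> T * (- (1 / 3) - 5 * \<epsilon>)" by (simp add: algebra_simps)
      assume "\<not> int n dvd x + 3 * y" "\<not> int n dvd x - 3 * y" "\<not> int n dvd 3 * x + y" "\<not> int n dvd 3 * x - y"
      from le(2)[OF this] eta have "- (1 - 20 / (3 * pi\<^sup>2)) - \<epsilon> \<le> corr m n x y" by linarith
      from s[OF cop this] show "s x y \<ge> T * (- (1 - 20 / (3 * pi\<^sup>2)) - 5 * \<epsilon>)" by (simp add: algebra_simps)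
    qed
    have "\<exists>(x, y) \<in> {(1, a), (1, b), (a, b)}. s x y \<ge> T * (- (1 - 20 / (3 * pi\<^sup>2)) - 5 * \<epsilon>)"
      using good pair(2)[of 1 a] pair(2)[of 1 b] pair(2)[of a b] by (auto simp: cong_0_iff)
    moreover have "s 1 a \<ge> T * (- (1 / 3) - 5 * \<epsilon>)" "s 1 b \<ge> T * (- (1 / 3) - 5 * \<epsilon>)" "s a b \<ge> T * (- (1 / 3) - 5 * \<epsilon>)"
      using pair(1) by auto
    ultimately have "s 1 a + s 1 b + s a b \<ge> T * (- (1 - 20 / (3 * pi\<^sup>2)) - 5 * \<epsilon>) + 2 * (T * (- (1 / 3) - 5 * \<epsilon>))"
      by auto
    moreover have "T + (T * (- (1 - 20 / (3 * pi\<^sup>2)) - 5 * \<epsilon>) + 2 * (T * (- (1 / 3) - 5 * \<epsilon>))) = T * (\<delta> - 15 * \<epsilon>)"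
      by (simp add: \<delta>_def algebra_simps)
    \<comment> \<open>What remains is \<delta> / 2; the factor 8 in the counting identity turns it
      into the constant \<delta> / 16.\<close>
    moreover have "T * (\<delta> - 15 * \<epsilon>) = 8 * (\<delta> / 16 * T)" by (simp add: \<epsilon>_def)
    ultimately have "8 * (\<delta> / 16 * T) \<le> T + s 1 a + s 1 b + s a b" by linarith
    then show ?thesis
      using card_half_interval_units[OF odd n1 ab] by (simp only: T_def s_def)
  qed
  show ?thesis
  proof (intro exI[of _ "\<delta> / 16"] exI[of _ N] conjI)
    show "\<delta> / 16 > 0" using \<open>\<delta> > 0\<close> by simp
  qed (use main in blast)
qed

end
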